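(* Let $v(0)\in\mathcal N^*$ and let $v(t)$ be the solution of the critical equations with initial condition $v(0)$. Then the gelation time $t_{gel}:=\inf\{t:m_1(t)=+\infty\}$ equals $1/m_1(0)$; there is a positive continuous function $\varphi_{crit}:[t_{gel},\infty)\to(0,\infty)$ with $\Phi(t)=\int_{t_{gel}}^t\varphi_{crit}(s)\,ds$ for $t\ge t_{gel}$, where $\Phi(t)=m_0(0)-m_0(t)$; and for all $t\ge t_{gel}$, $$\lim_{K\to\infty}K^{1/2}\sum_{k=K}^\infty v_k(t)=\sqrt{\frac{2\varphi_{crit}(t)}{\pi}}.$$
   Context: $\mathcal N$: sequences $v=(v_k)_{k\ge1}$ of nonnegative reals with $\sum_kv_k<\infty$; $\mathcal N^*$: those with finitely many nonzero terms; $m_0=\sum_kv_k$, $m_1=\sum_kkv_k$ (possibly $+\infty$). Critical equations: $v(t)\in\mathcal N$ for $t\ge0$ with $v_k(t)=v_k(0)+\int_0^t\big(\tfrac k2\sum_{l=1}^{k-1}v_l(s)v_{k-l}(s)-kv_k(s)m_0(s)\big)ds$ for all $k\ge1$, and $\Phi(t):=m_0(0)-m_0(t)$ nondecreasing with values in $[0,m_0(0))$; the solution is unique. *)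

theory Defs
  imports "HOL-Analysis.Analysis"
begin

text \<open>Sequences (v_k)_{k>=1} are modelled as functions nat => real; the unused
  index 0 is fixed to 0 by convention.\<close>

definition in_N :: "(nat \<Rightarrow> real) \<Rightarrow> bool" where
  "in_N v \<longleftrightarrow> (\<forall>k. 0 \<le> v k) \<and> v 0 = 0 \<and> summable v"

definition in_Nstar :: "(nat \<Rightarrow> real) \<Rightarrow> bool" where
  "in_Nstar v \<longleftrightarrow> in_N v \<and> finite {k. v k \<noteq> 0}"

definition m0 :: "(nat \<Rightarrow> real) \<Rightarrow> real" where
  "m0 v = (\<Sum>k. v k)"

definition m1 :: "(nat \<Rightarrow> real) \<Rightarrow> ereal" where
  "m1 v = (\<Sum>k. ereal (real k * v k))"

definition crit_rhs :: "(nat \<Rightarrow> real) \<Rightarrow> nat \<Rightarrow> real" where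
  "crit_rhs w k = real k / 2 * (\<Sum>l=1..k-1. w l * w (k - l)) - real k * w k * m0 w"

definition crit_solution :: "(real \<Rightarrow> nat \<Rightarrow> real) \<Rightarrow> bool" where
  "crit_solution v \<longleftrightarrow>
     (\<forall>t\<ge>0. in_N (v t)) \<and>
     (\<forall>k\<ge>1. \<forall>t\<ge>0. (\<lambda>s. crit_rhs (v s) k) integrable_on {0..t} \<and>
                      v t k = v 0 k + integral {0..t} (\<lambda>s. crit_rhs (v s) k)) \<and>
     mono_on {0..} (\<lambda>t. m0 (v 0) - m0 (v t)) \<and>
     (\<forall>t\<ge>0. 0 \<le> m0 (v 0) - m0 (v t) \<and> m0 (v 0) - m0 (v t) < m0 (v 0))"

end

theory Submission
  imports Defs "HOL-Probability.Distributions" "HOL-Real_Asymp.Real_Asymp"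
begin

text \<open>The Laplace transform \<open>V(t,x) = \<Sum>k. v_k(t) exp (- k x)\<close> solves the Burgers type equation
  \<open>V_t = (m0(t) - V) V_x\<close>. Along characteristics this gives
  \<open>V(0, x + \<mu>(t) - t V(t,x)) = V(t,x)\<close> with \<open>\<mu>(t)\<close> the integral of \<open>m0\<close> over \<open>[0,t]\<close>. As \<open>x\<close> tends
  to \<open>0\<close>, the foot \<open>y(t) = \<mu>(t) - t m0(t)\<close> satisfies \<open>V(0, y(t)) = m0(t)\<close> and \<open>- t V_x(0, y(t)) \<le> 1\<close>;
  monotonicity of \<open>m0\<close> forces \<open>y(t) = 0\<close> before \<open>1 / m1(0)\<close> and \<open>- t V_x(0, y(t)) = 1\<close> afterwards, whence
  \<open>\<phi>(t) = 1 / (t^3 V_xx(0, y(t)))\<close>. Expanding \<open>V(0, _)\<close> to second order at \<open>y(t)\<close> gives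
  \<open>m0(t) - V(t,x) \<sim> sqrt (2 \<phi>(t) x)\<close>, and Karamata's Tauberian theorem turns this into the asymptotics
  of the tails.\<close>

text \<open>The equations are used at \<open>x > 0\<close>, where the series can be differentiated
  term by term; at \<open>x = 0\<close> the slope of \<open>V(t,_)\<close> is \<open>- m1\<close>,
  infinite after gelation, so statements there are limits from the right. Put
  \<open>D = m0(t) - V(t,x)\<close>. Moving \<open>x\<close> off \<open>0\<close> moves the foot by
  \<open>h = x + t D\<close> and lowers \<open>V(0,_)\<close> by \<open>D\<close>; since
  \<open>D / h \<le> 1 / t\<close>, the slope bound at \<open>y(t)\<close> follows. While that slope
  is below \<open>1 / t\<close>, \<open>D\<close> is of order \<open>x\<close>. Once it equals
  \<open>1 / t\<close>, the linear terms cancel and \<open>x / t\<close> is balanced by the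
  quadratic term in \<open>h\<close>: this is the origin of the square root. The Tauberian theorem
  is applied to the tails because they decrease, which is what passes from partial sums to single
  terms. Their transform is \<open>D / (1 - exp (- x))\<close> plus a bounded term, hence of order
  \<open>1 / sqrt x\<close>. Finite support extends \<open>V(0,_)\<close> to the whole real line, so
  \<open>- t V_x(0,y) = 1\<close> has a solution for every \<open>t > 0\<close>, and this solution
  passes differentiably through the gelation time.\<close>

section \<open>Karamata's Tauberian theorem with exponent 1/2\<close>

text \<open>With \<open>s = exp (- r\<^sup>2)\<close> this is the positive functional whose value at \<open>s ^ j\<close> is
  \<open>1 / sqrt (j + 1)\<close>, the factor produced by replacing \<open>x\<close> by \<open>(j + 1) * x\<close> in \<open>C / sqrt x\<close>.\<close>

definition gauss_mean :: "(real \<Rightarrow> real) \<Rightarrow> real" where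
  "gauss_mean h = 2 / sqrt pi * (\<integral>r. indicator {0..} r * exp (- r\<^sup>2) * h (exp (- r\<^sup>2)) \<partial>lborel)"

text \<open>The integrand is the half Gaussian at \<open>sqrt (j + 1) * r\<close>, so rescaling the
  integral \<open>sqrt pi / 2\<close> gives the factor.\<close>

lemma has_bochner_integral_gauss_power:
  "has_bochner_integral lborel (\<lambda>r. indicator {0..} r * exp (- r\<^sup>2) * exp (- r\<^sup>2) ^ j)
     (sqrt pi / 2 / sqrt (real (Suc j)))"
proof -
  let ?c = "sqrt (real (Suc j))"
  have "has_bochner_integral lborel (\<lambda>r. indicator {0..} (0 + ?c * r) *\<^sub>R exp (- (0 + ?c * r)\<^sup>2))
     ((sqrt pi / 2) /\<^sub>R \<bar>?c\<bar>)"
    using gaussian_moment_0 by (subst lborel_has_bochner_integral_real_affine_iff[symmetric]) auto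
  moreover have "indicator {0..} (0 + ?c * r) *\<^sub>R exp (- (0 + ?c * r)\<^sup>2)
      = indicator {0..} r * exp (- r\<^sup>2) * exp (- r\<^sup>2) ^ j" for r :: real
    by (auto simp: indicator_def power_mult_distrib zero_le_mult_iff algebra_simps
        simp flip: exp_of_nat_mult exp_add)
  ultimately show ?thesis
    by (simp add: field_simps)
qed

lemma continuous_bounded_unit_interval:
  fixes h :: "real \<Rightarrow> real"
  assumes "continuous_on UNIV h"
  shows "\<exists>M. \<forall>s\<in>{0..1}. \<bar>h s\<bar> \<le> M"
proof -
  have "compact (h ` {0..1})"
    using continuous_on_subset[OF assms] by (intro compact_continuous_image compact_Icc) auto
  then show ?thesis
    by (auto dest!: compact_imp_bounded simp: bounded_iff)
qed

lemma gauss_mean_integrable: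
  fixes h :: "real \<Rightarrow> real"
  assumes "continuous_on UNIV h"
  shows "integrable lborel (\<lambda>r. indicator {0..} r * exp (- r\<^sup>2) * h (exp (- r\<^sup>2)))"
proof -
  obtain M where M: "\<And>s. s \<in> {0..1} \<Longrightarrow> \<bar>h s\<bar> \<le> M"
    using continuous_bounded_unit_interval[OF assms] by blast
  have meas [measurable]: "h \<in> borel_measurable borel"
    using assms by (rule borel_measurable_continuous_onI)
  have "integrable lborel (\<lambda>r. M * (indicator {0..} r * exp (- r\<^sup>2) :: real))"
    using has_bochner_integral_gauss_power[of 0]
    by (intro integrable_mult_right) (simp add: has_bochner_integral_iff)
  then show ?thesis
  proof (rule Bochner_Integration.integrable_bound)
    show "AE r in lborel. norm (indicator {0..} r * exp (- r\<^sup>2) * h (exp (- r\<^sup>2)))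
            \<le> norm (M * (indicator {0..} r * exp (- r\<^sup>2) :: real))"
    proof (rule AE_I2)
      fix r :: real
      have "\<bar>h (exp (- r\<^sup>2))\<bar> \<le> \<bar>M\<bar>"
        using M[of "exp (- r\<^sup>2)"] by simp
      then show "norm (indicator {0..} r * exp (- r\<^sup>2) * h (exp (- r\<^sup>2)))
            \<le> norm (M * (indicator {0..} r * exp (- r\<^sup>2) :: real))"
        by (auto simp: indicator_def abs_mult mult.commute)
    qed
  qed simp
qed

lemma gauss_mean_mono:
  assumes "continuous_on UNIV f" "continuous_on UNIV g" "\<And>s. s \<in> {0<..1} \<Longrightarrow> f s \<le> g s"
  shows "gauss_mean f \<le> gauss_mean g"
  unfolding gauss_mean_def
  by (intro mult_left_mono integral_mono gauss_mean_integrable assms)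
     (auto simp: indicator_def intro!: assms)

lemma gauss_mean_sum_powers:
  "gauss_mean (\<lambda>s. \<Sum>i\<le>n. b i * s ^ i) = (\<Sum>i\<le>n. b i / sqrt (real (Suc i)))"
proof -
  have "has_bochner_integral lborel
     (\<lambda>r. \<Sum>i\<le>n. b i * (indicator {0..} r * exp (- r\<^sup>2) * exp (- r\<^sup>2) ^ i))
     (\<Sum>i\<le>n. b i * (sqrt pi / 2 / sqrt (real (Suc i))))"
    by (intro has_bochner_integral_sum has_bochner_integral_mult_right has_bochner_integral_gauss_power)
  then have "(\<integral>r. indicator {0..} r * exp (- r\<^sup>2) * (\<Sum>i\<le>n. b i * exp (- r\<^sup>2) ^ i) \<partial>lborel)
     = (\<Sum>i\<le>n. b i * (sqrt pi / 2 / sqrt (real (Suc i))))"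
    by (simp add: has_bochner_integral_iff sum_distrib_left mult_ac)
  then show ?thesis
    by (simp add: gauss_mean_def sum_distrib_left field_simps)
qed

text \<open>The normalisation \<open>2 / sqrt pi\<close> gives the weight total mass one. Together
  with monotonicity this makes a uniform error \<open>e\<close> in \<open>f\<close> cost at most
  \<open>e\<close> in the mean.\<close>

lemma gauss_mean_add_const:
  assumes "continuous_on UNIV f"
  shows "gauss_mean (\<lambda>s. f s + c) = gauss_mean f + c"
proof -
  have 1: "has_bochner_integral lborel (\<lambda>r. indicator {0..} r * exp (- r\<^sup>2) :: real) (sqrt pi / 2)"
    using has_bochner_integral_gauss_power[of 0] by simp
  have "(\<integral>r. indicator {0..} r * exp (- r\<^sup>2) * (f (exp (- r\<^sup>2)) + c) \<partial>lborel)
     = (\<integral>r. indicator {0..} r * exp (- r\<^sup>2) * f (exp (- r\<^sup>2)) \<partial>lborel) + sqrt pi / 2 * c"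
    unfolding distrib_left
    using 1 gauss_mean_integrable[OF assms]
    by (subst Bochner_Integration.integral_add) (auto simp: has_bochner_integral_iff)
  then show ?thesis
    by (simp add: gauss_mean_def field_simps)
qed

section \<open>Laplace weights tested against powers, polynomials and continuous functions\<close>

locale half_laplace =
  fixes a :: "nat \<Rightarrow> real" and C :: real
  assumes nonneg: "0 \<le> a n"
    and summ: "0 < x \<Longrightarrow> summable (\<lambda>n. a n * exp (- (real n * x)))"
    and lim: "((\<lambda>x. sqrt x * (\<Sum>n. a n * exp (- (real n * x)))) \<longlongrightarrow> C) (at_right 0)"
begin

lemma limit_nonneg: "0 \<le> C"
proof (rule tendsto_lowerbound[OF lim])
  show "\<forall>\<^sub>F x in at_right 0. 0 \<le> sqrt x * (\<Sum>n. a n * exp (- (real n * x)))"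
    using eventually_at_right_less[of 0]
    by eventually_elim (auto intro!: mult_nonneg_nonneg suminf_nonneg summ nonneg)
qed simp

lemma summable_test:
  assumes "0 < x" "\<And>s. s \<in> {0..1} \<Longrightarrow> \<bar>h s\<bar> \<le> M"
  shows "summable (\<lambda>n. a n * exp (- (real n * x)) * h (exp (- (real n * x))))"
proof (rule summable_comparison_test')
  show "summable (\<lambda>n. a n * exp (- (real n * x)) * M)"
    using summ[OF assms(1)] by (rule summable_mult2)
  show "norm (a n * exp (- (real n * x)) * h (exp (- (real n * x)))) \<le> a n * exp (- (real n * x)) * M" for n
    using assms nonneg[of n] by (auto simp: abs_mult intro!: mult_left_mono)
qed

lemma tendsto_power_test:
  "((\<lambda>x. sqrt x * (\<Sum>n. a n * exp (- (real n * x)) * exp (- (real n * x)) ^ j)) \<longlongrightarrow> C / sqrt (real (Suc j))) (at_right 0)"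
proof -
  have f: "filterlim (\<lambda>x. real (Suc j) * x) (at_right 0) (at_right 0)"
    by (intro filterlim_times_pos[where c = "real (Suc j)" and p = 0 and l = 0]) (auto simp: filterlim_ident)
  have "((\<lambda>x. (sqrt (real (Suc j) * x) * (\<Sum>n. a n * exp (- (real n * (real (Suc j) * x))))) / sqrt (real (Suc j)))
      \<longlongrightarrow> C / sqrt (real (Suc j))) (at_right 0)"
    by (intro tendsto_divide tendsto_const filterlim_compose[OF lim f]) auto
  moreover have "exp (- (real n * (real (Suc j) * x))) = exp (- (real n * x)) * exp (- (real n * x)) ^ j" for n x
    by (simp add: algebra_simps flip: exp_of_nat_mult exp_add)
  ultimately show ?thesis
    by (simp add: real_sqrt_mult mult_ac)
qed

lemma tendsto_polynomial_test:
  "((\<lambda>x. sqrt x * (\<Sum>n. a n * exp (- (real n * x)) * (\<Sum>i\<le>m. b i * exp (- (real n * x)) ^ i)))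
     \<longlongrightarrow> C * gauss_mean (\<lambda>s. \<Sum>i\<le>m. b i * s ^ i)) (at_right 0)"
proof -
  have "((\<lambda>x. \<Sum>i\<le>m. b i * (sqrt x * (\<Sum>n. a n * exp (- (real n * x)) * exp (- (real n * x)) ^ i)))
     \<longlongrightarrow> (\<Sum>i\<le>m. b i * (C / sqrt (real (Suc i))))) (at_right 0)"
    by (intro tendsto_sum tendsto_mult tendsto_const tendsto_power_test)
  moreover have "\<forall>\<^sub>F x in at_right 0.
     (\<Sum>i\<le>m. b i * (sqrt x * (\<Sum>n. a n * exp (- (real n * x)) * exp (- (real n * x)) ^ i))) =
     sqrt x * (\<Sum>n. a n * exp (- (real n * x)) * (\<Sum>i\<le>m. b i * exp (- (real n * x)) ^ i))"
    using eventually_at_right_less[of 0]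
  proof eventually_elim
    case (elim x)
    have s: "summable (\<lambda>n. a n * exp (- (real n * x)) * exp (- (real n * x)) ^ i)" for i
      by (rule summable_test[where M = 1 and h = "\<lambda>s. s ^ i"]) (use elim in \<open>auto simp: power_le_one\<close>)
    have "(\<Sum>n. a n * exp (- (real n * x)) * (\<Sum>i\<le>m. b i * exp (- (real n * x)) ^ i))
       = (\<Sum>n. \<Sum>i\<le>m. b i * (a n * exp (- (real n * x)) * exp (- (real n * x)) ^ i))"
      by (simp add: sum_distrib_left mult_ac)
    also have "\<dots> = (\<Sum>i\<le>m. \<Sum>n. b i * (a n * exp (- (real n * x)) * exp (- (real n * x)) ^ i))"
      by (intro suminf_sum summable_mult s)
    also have "\<dots> = (\<Sum>i\<le>m. b i * (\<Sum>n. a n * exp (- (real n * x)) * exp (- (real n * x)) ^ i))"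
      by (intro sum.cong refl suminf_mult s)
    finally show ?case
      by (simp add: sum_distrib_left mult_ac)
  qed
  ultimately show ?thesis
    by (auto simp: gauss_mean_sum_powers sum_distrib_left mult_ac elim: Lim_transform_eventually)
qed

text \<open>Polynomials approximate \<open>h\<close> uniformly on \<open>{0..1}\<close>, where all
  weights \<open>exp (- (real n * x))\<close> lie; nonnegativity of \<open>a\<close> and boundedness
  of the rescaled total mass make the error uniform in \<open>x\<close>.\<close>

lemma tendsto_continuous_test:
  assumes h: "continuous_on UNIV h"
  shows "((\<lambda>x. sqrt x * (\<Sum>n. a n * exp (- (real n * x)) * h (exp (- (real n * x)))))
     \<longlongrightarrow> C * gauss_mean h) (at_right 0)"
proof (rule tendstoI)
  fix e' :: real
  assume "0 < e'"
  \<comment> \<open>The three errors are \<open>(C + 1) * e\<close> for replacing \<open>h\<close>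
    by \<open>p\<close> in the series, \<open>e\<close> for the polynomial limit and
    \<open>C * e\<close> for replacing \<open>p\<close> by \<open>h\<close> in the mean; they add up
    to \<open>(2 * C + 2) * e\<close>.\<close>
  define e where "e = e' / (2 * C + 2)"
  have e: "0 < e" "e' = e * (2 * C + 2)"
    using \<open>0 < e'\<close> limit_nonneg by (auto simp: e_def field_simps)
  obtain p where p: "real_polynomial_function p" "\<And>s. s \<in> {0..1} \<Longrightarrow> \<bar>h s - p s\<bar> < e"
    using Stone_Weierstrass_real_polynomial_function[of "{0..1}" h e] h e by (auto intro: continuous_on_subset)
  then obtain b m where pbm: "p = (\<lambda>s. \<Sum>i\<le>m. b i * s ^ i)"
    by (auto simp: real_polynomial_function_iff_sum)
  have cp: "continuous_on UNIV p"
    unfolding pbm by (intro continuous_intros)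
  have "gauss_mean h \<le> gauss_mean p + e"
    unfolding gauss_mean_add_const[OF cp, symmetric]
    by (rule gauss_mean_mono) (use h cp p(2) in \<open>auto intro!: continuous_intros simp: abs_less_iff algebra_simps less_imp_le\<close>)
  moreover have "gauss_mean p \<le> gauss_mean h + e"
    unfolding gauss_mean_add_const[OF h, symmetric]
    by (rule gauss_mean_mono) (use h cp p(2) in \<open>auto intro!: continuous_intros simp: abs_less_iff algebra_simps less_imp_le\<close>)
  ultimately have I: "\<bar>C * gauss_mean p - C * gauss_mean h\<bar> \<le> C * e"
    using limit_nonneg by (auto simp: abs_le_iff mult_left_mono simp flip: right_diff_distrib mult_minus_right abs_mult)
  have "\<forall>\<^sub>F x in at_right 0. dist (sqrt x * (\<Sum>n. a n * exp (- (real n * x)) * p (exp (- (real n * x))))) (C * gauss_mean p) < e"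
    using tendstoD[OF tendsto_polynomial_test[of b m]] e by (simp add: pbm)
  moreover have "\<forall>\<^sub>F x in at_right 0. sqrt x * (\<Sum>n. a n * exp (- (real n * x))) < C + 1"
    using order_tendstoD(2)[OF lim, of "C + 1"] by simp
  ultimately show "\<forall>\<^sub>F x in at_right 0. dist (sqrt x * (\<Sum>n. a n * exp (- (real n * x)) * h (exp (- (real n * x))))) (C * gauss_mean h) < e'"
    using eventually_at_right_less[of 0]
  proof eventually_elim
    case (elim x)
    let ?T = "\<lambda>f. \<Sum>n. a n * exp (- (real n * x)) * f (exp (- (real n * x)))"
    obtain Mh where Mh: "\<And>s. s \<in> {0..1} \<Longrightarrow> \<bar>h s\<bar> \<le> Mh" using continuous_bounded_unit_interval[OF h] by blast
    obtain Mp where Mp: "\<And>s. s \<in> {0..1} \<Longrightarrow> \<bar>p s\<bar> \<le> Mp" using continuous_bounded_unit_interval[OF cp] by blast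
    note s = summ[OF elim(3)]
    have sh: "summable (\<lambda>n. a n * exp (- (real n * x)) * h (exp (- (real n * x))))"
      using summable_test[OF elim(3), of h Mh] Mh by blast
    have sp: "summable (\<lambda>n. a n * exp (- (real n * x)) * p (exp (- (real n * x))))"
      using summable_test[OF elim(3), of p Mp] Mp by blast
    have "\<bar>?T h - ?T p\<bar> = \<bar>\<Sum>n. a n * exp (- (real n * x)) * h (exp (- (real n * x))) - a n * exp (- (real n * x)) * p (exp (- (real n * x)))\<bar>"
      by (simp add: suminf_diff[OF sh sp])
    also have "\<dots> \<le> (\<Sum>n. a n * exp (- (real n * x)) * e)"
    proof -
      have *: "\<bar>a n * exp (- (real n * x)) * h (exp (- (real n * x))) - a n * exp (- (real n * x)) * p (exp (- (real n * x)))\<bar> \<le> a n * exp (- (real n * x)) * e" for n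
        using p(2)[of "exp (- (real n * x))"] elim(3) nonneg[of n]
        by (auto simp: abs_mult intro!: mult_left_mono simp flip: right_diff_distrib)
      show ?thesis
        using norm_suminf_le[of "\<lambda>n. a n * exp (- (real n * x)) * h (exp (- (real n * x))) - a n * exp (- (real n * x)) * p (exp (- (real n * x)))" "\<lambda>n. a n * exp (- (real n * x)) * e"] * summable_mult2[OF s]
        by simp
    qed
    also have "\<dots> = (\<Sum>n. a n * exp (- (real n * x))) * e"
      by (rule suminf_mult2[OF s, symmetric])
    finally have "sqrt x * \<bar>?T h - ?T p\<bar> \<le> sqrt x * ((\<Sum>n. a n * exp (- (real n * x))) * e)"
      using elim(3) by (intro mult_left_mono) auto
    also have "\<dots> \<le> (C + 1) * e"
      using elim(2) e(1) by (simp add: mult_ac mult_left_mono less_imp_le flip: mult.assoc)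
    finally have "\<bar>sqrt x * ?T h - sqrt x * ?T p\<bar> \<le> (C + 1) * e"
      using elim(3) by (simp add: abs_mult flip: right_diff_distrib)
    then show ?case
      using elim(1) I e(2) by (simp add: dist_real_def algebra_simps)
  qed
qed

end

text \<open>A continuous approximation to \<open>1 / s\<close> on \<open>s \<ge> exp (- 1)\<close>: multiplied by the weight
  \<open>s = exp (- (n * x))\<close> it becomes nearly the indicator of \<open>n \<le> 1 / x\<close>.\<close>

definition cutoff :: "real \<Rightarrow> real \<Rightarrow> real \<Rightarrow> real" where
  "cutoff \<alpha> \<beta> s = min 1 (max 0 ((s - \<alpha>) / (\<beta> - \<alpha>))) / max s \<alpha>"

lemma continuous_on_cutoff: "0 < \<alpha> \<Longrightarrow> \<alpha> < \<beta> \<Longrightarrow> continuous_on S (cutoff \<alpha> \<beta>)"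
  unfolding cutoff_def by (intro continuous_intros) (auto simp: max_def)

lemma mult_cutoff:
  assumes "0 < \<alpha>" "\<alpha> < \<beta>" "0 < s"
  shows "\<beta> \<le> s \<Longrightarrow> s * cutoff \<alpha> \<beta> s = 1" "s \<le> \<alpha> \<Longrightarrow> s * cutoff \<alpha> \<beta> s = 0"
    "0 \<le> s * cutoff \<alpha> \<beta> s" "s * cutoff \<alpha> \<beta> s \<le> 1"
  using assms by (auto simp: cutoff_def min_def max_def field_simps)

text \<open>Multiplied by its weight \<open>exp (- r\<twosuperior>)\<close>, the cutoff lies between
  the indicators of \<open>r \<le> sqrt a\<close> and \<open>r \<le> sqrt b\<close> on the half
  line.\<close>

lemma gauss_mean_cutoff:
  assumes "0 < a" "a < b"
  shows "2 / sqrt pi * sqrt a \<le> gauss_mean (cutoff (exp (- b)) (exp (- a)))"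
    and "gauss_mean (cutoff (exp (- b)) (exp (- a))) \<le> 2 / sqrt pi * sqrt b"
proof -
  let ?h = "cutoff (exp (- b)) (exp (- a))"
  let ?g = "\<lambda>r. indicator {0..} r * exp (- r\<^sup>2) * ?h (exp (- r\<^sup>2))"
  have int: "integrable lborel ?g"
    using assms by (intro gauss_mean_integrable continuous_on_cutoff) auto
  have ind: "(\<integral>r. indicator {0..sqrt c} r \<partial>lborel) = sqrt c"
    "integrable lborel (indicator {0..sqrt c} :: real \<Rightarrow> real)" if "0 < c" for c
    using that by auto
  have sq: "r \<le> sqrt c \<longleftrightarrow> r\<^sup>2 \<le> c" if "0 \<le> r" for r c :: real
    using that by (metis abs_of_nonneg real_sqrt_abs real_sqrt_le_iff)
  have "indicator {0..sqrt a} r \<le> ?g r" for r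
    using assms mult_cutoff[of "exp (- b)" "exp (- a)" "exp (- r\<^sup>2)"] by (auto simp: indicator_def sq)
  then have "sqrt a \<le> (\<integral>r. ?g r \<partial>lborel)"
    using integral_mono[OF ind(2) int, of a] assms ind(1)[of a] by simp
  then show "2 / sqrt pi * sqrt a \<le> gauss_mean ?h"
    unfolding gauss_mean_def by (intro mult_left_mono) auto
  have "?g r \<le> indicator {0..sqrt b} r" for r
    using assms mult_cutoff[of "exp (- b)" "exp (- a)" "exp (- r\<^sup>2)"] by (auto simp: indicator_def sq)
  then have "(\<integral>r. ?g r \<partial>lborel) \<le> sqrt b"
    using integral_mono[OF int ind(2), of b] assms ind(1)[of b] by simp
  then show "gauss_mean ?h \<le> 2 / sqrt pi * sqrt b"
    unfolding gauss_mean_def by (intro mult_left_mono) auto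
qed

section \<open>From cutoffs to partial sums, and from partial sums to monotone terms\<close>

context half_laplace
begin

lemma tendsto_cutoff_test:
  assumes "0 < c" "c < d"
  shows "(\<lambda>N. (\<Sum>n. a n * (exp (- (real n / real N)) * cutoff (exp (- d)) (exp (- c)) (exp (- (real n / real N))))) / sqrt (real N))
     \<longlonglongrightarrow> C * gauss_mean (cutoff (exp (- d)) (exp (- c)))"
proof -
  have "filterlim (\<lambda>N. 1 / real N) (at_right 0) sequentially"
    by real_asymp
  from filterlim_compose[OF tendsto_continuous_test this, of "cutoff (exp (- d)) (exp (- c))"]
  show ?thesis
    using assms by (simp add: continuous_on_cutoff real_sqrt_divide mult_ac)
qed

lemma summable_cutoff_test:
  assumes "0 < c" "c < d" "0 < N"
  shows "summable (\<lambda>n. a n * (exp (- (real n / real N)) * cutoff (exp (- d)) (exp (- c)) (exp (- (real n / real N)))))"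
proof -
  obtain M where "\<forall>s\<in>{0..1}. \<bar>cutoff (exp (- d)) (exp (- c)) s\<bar> \<le> M"
    using continuous_bounded_unit_interval[OF continuous_on_cutoff] assms by force
  then show ?thesis
    using summable_test[of "1 / real N" "cutoff (exp (- d)) (exp (- c))" M] assms by (simp add: mult_ac)
qed

text \<open>Take \<open>x = 1 / N\<close>. For the upper bound the cutoff is full up to
  \<open>n = N\<close> and vanishes from \<open>d * N\<close> on; for the lower bound it is full up
  to \<open>c * N\<close> and vanishes from \<open>N\<close> on. Nonnegativity of \<open>a\<close>
  allows both comparisons, and \<open>d\<close> and \<open>c\<close> are taken close enough to
  \<open>1\<close>.\<close>

lemma karamata: "(\<lambda>N. (\<Sum>n\<le>N. a n) / sqrt (real N)) \<longlonglongrightarrow> 2 * C / sqrt pi"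
proof (rule order_tendstoI)
  fix u
  assume u: "2 * C / sqrt pi < u"
  have "((\<lambda>d. C * (2 / sqrt pi * sqrt d)) \<longlongrightarrow> C * (2 / sqrt pi * sqrt 1)) (at_right 1)"
    by (intro tendsto_intros)
  then have "\<forall>\<^sub>F d in at_right 1. C * (2 / sqrt pi * sqrt d) < u"
    using u by (intro order_tendstoD) (auto simp: mult_ac)
  then obtain d where d: "1 < d" "C * (2 / sqrt pi * sqrt d) < u"
    using eventually_happens'[OF trivial_limit_at_right_real eventually_conj[OF _ eventually_at_right_less]] by blast
  have "C * gauss_mean (cutoff (exp (- d)) (exp (- 1))) < u"
    by (rule le_less_trans[OF mult_left_mono[OF gauss_mean_cutoff(2)[OF zero_less_one d(1)] limit_nonneg] d(2)])
  from order_tendstoD(2)[OF tendsto_cutoff_test this] d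
  have "\<forall>\<^sub>F N in sequentially. (\<Sum>n. a n * (exp (- (real n / real N)) * cutoff (exp (- d)) (exp (- 1)) (exp (- (real n / real N))))) / sqrt (real N) < u"
    by simp
  then show "\<forall>\<^sub>F N in sequentially. (\<Sum>n\<le>N. a n) / sqrt (real N) < u"
    using eventually_gt_at_top[of 0]
  proof eventually_elim
    case (elim N)
    have "(\<Sum>n\<le>N. a n) = (\<Sum>n\<le>N. a n * (exp (- (real n / real N)) * cutoff (exp (- d)) (exp (- 1)) (exp (- (real n / real N)))))"
      using elim d by (intro sum.cong refl) (subst mult_cutoff(1), auto)
    also have "\<dots> \<le> (\<Sum>n. a n * (exp (- (real n / real N)) * cutoff (exp (- d)) (exp (- 1)) (exp (- (real n / real N)))))"
      using elim d by (intro sum_le_suminf summable_cutoff_test ballI mult_nonneg_nonneg[OF nonneg] mult_cutoff(3)) auto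
    finally show ?case
      using elim by (intro le_less_trans[OF _ elim(1)] divide_right_mono) auto
  qed
next
  fix u
  assume u: "u < 2 * C / sqrt pi"
  have "((\<lambda>d. C * (2 / sqrt pi * sqrt d)) \<longlongrightarrow> C * (2 / sqrt pi * sqrt 1)) (at_left 1)"
    by (intro tendsto_intros)
  then have "\<forall>\<^sub>F c in at_left 1. u < C * (2 / sqrt pi * sqrt c)"
    using u by (intro order_tendstoD) (auto simp: mult_ac)
  moreover have "\<forall>\<^sub>F c in at_left 1. c \<in> {0<..<1::real}"
    by (rule eventually_at_leftI[of 0]) auto
  ultimately have "\<forall>\<^sub>F c in at_left 1. u < C * (2 / sqrt pi * sqrt c) \<and> c \<in> {0<..<1}"
    by (rule eventually_conj)
  from eventually_happens'[OF trivial_limit_at_left_real this]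
  obtain c where c: "0 < c" "c < 1" "u < C * (2 / sqrt pi * sqrt c)"
    by auto
  have "u < C * gauss_mean (cutoff (exp (- 1)) (exp (- c)))"
    by (rule less_le_trans[OF c(3) mult_left_mono[OF gauss_mean_cutoff(1)[OF c(1,2)] limit_nonneg]])
  from order_tendstoD(1)[OF tendsto_cutoff_test this] c
  have "\<forall>\<^sub>F N in sequentially. u < (\<Sum>n. a n * (exp (- (real n / real N)) * cutoff (exp (- 1)) (exp (- c)) (exp (- (real n / real N))))) / sqrt (real N)"
    by simp
  then show "\<forall>\<^sub>F N in sequentially. u < (\<Sum>n\<le>N. a n) / sqrt (real N)"
    using eventually_gt_at_top[of 0]
  proof eventually_elim
    case (elim N)
    have "(\<Sum>n. a n * (exp (- (real n / real N)) * cutoff (exp (- 1)) (exp (- c)) (exp (- (real n / real N)))))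
       = (\<Sum>n\<le>N. a n * (exp (- (real n / real N)) * cutoff (exp (- 1)) (exp (- c)) (exp (- (real n / real N)))))"
      using elim c by (intro suminf_finite) (auto simp: mult_cutoff(2) field_simps)
    also have "\<dots> \<le> (\<Sum>n\<le>N. a n)"
      using c by (intro sum_mono mult_left_le nonneg mult_cutoff(4)) auto
    finally show ?case
      using elim by (intro less_le_trans[OF elim(1)] divide_right_mono) auto
  qed
qed

lemma karamata_floor:
  assumes "0 < c"
  shows "(\<lambda>N. (\<Sum>n\<le>nat \<lfloor>c * real N\<rfloor>. a n) / sqrt (real N)) \<longlonglongrightarrow> 2 * C / sqrt pi * sqrt c"
proof -
  let ?m = "\<lambda>N. nat \<lfloor>c * real N\<rfloor>"
  have m: "filterlim ?m sequentially sequentially"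
    using assms by real_asymp
  have r: "(\<lambda>N. real (?m N) / real N) \<longlonglongrightarrow> c"
    using assms by real_asymp
  have "(\<lambda>N. (\<Sum>n\<le>?m N. a n) / sqrt (real (?m N)) * sqrt (real (?m N) / real N)) \<longlonglongrightarrow> 2 * C / sqrt pi * sqrt c"
    by (intro tendsto_mult filterlim_compose[OF karamata m] tendsto_real_sqrt r)
  moreover have "\<forall>\<^sub>F N in sequentially. 0 < ?m N"
    by (rule eventually_compose_filterlim[OF eventually_gt_at_top m])
  then have "\<forall>\<^sub>F N in sequentially. (\<Sum>n\<le>?m N. a n) / sqrt (real (?m N)) * sqrt (real (?m N) / real N)
      = (\<Sum>n\<le>?m N. a n) / sqrt (real N)"
  proof eventually_elim
    case (elim N)
    define m where "m = ?m N"
    show ?case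
      using elim unfolding m_def[symmetric] by (simp add: real_sqrt_divide)
  qed
  ultimately show ?thesis
    by (rule Lim_transform_eventually)
qed

text \<open>A term is compared with the average over the window between \<open>c * N\<close> and
  \<open>N\<close>: for \<open>c < 1\<close> the window terms are at least \<open>a N\<close>, for
  \<open>c > 1\<close> at most \<open>a N\<close>, and rounding errs in the favourable direction
  both times. The window averages, scaled by \<open>sqrt N\<close>, tend to
  \<open>?L / (sqrt c + 1)\<close>, which tends to half of \<open>?L\<close> as \<open>c\<close>
  approaches \<open>1\<close>.\<close>

lemma monotone_tauberian:
  assumes "antimono a"
  shows "(\<lambda>N. sqrt (real N) * a N) \<longlonglongrightarrow> C / sqrt pi"
proof -
  let ?S = "\<lambda>N. \<Sum>n\<le>N. a n" and ?m = "\<lambda>c N. nat \<lfloor>c * real N\<rfloor>" and ?L = "2 * C / sqrt pi"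
  have lim_q: "(\<lambda>N. (?S (?m c N) / sqrt (real N) - ?S N / sqrt (real N)) / (c - 1)) \<longlonglongrightarrow> ?L / (sqrt c + 1)"
    if "0 < c" "c \<noteq> 1" for c
  proof -
    have "(?L * sqrt c - ?L) / (c - 1) = ?L * (sqrt c - 1) / ((sqrt c - 1) * (sqrt c + 1))"
      using that by (intro arg_cong2[where f = divide]) (auto simp: algebra_simps diff_divide_distrib)
    also have "\<dots> = ?L / (sqrt c + 1)"
    proof -
      have "sqrt c - 1 \<noteq> 0"
        using that by simp
      then show ?thesis
        by (subst mult.commute) (rule mult_divide_mult_cancel_left)
    qed
    finally have eq: "(?L * sqrt c - ?L) / (c - 1) = ?L / (sqrt c + 1)" .
    show ?thesis
      unfolding eq[symmetric] using that by (intro tendsto_divide tendsto_diff karamata_floor karamata tendsto_const) auto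
  qed
  have lim_L: "((\<lambda>c. ?L / (sqrt c + 1)) \<longlongrightarrow> C / sqrt pi) (at 1)"
    by (rule tendsto_eq_intros refl | simp)+
  have step: "sqrt (real N) * x = (real N * x) / sqrt (real N)" for N x
    by (cases "N = 0") (auto simp: field_simps)
  show ?thesis
  proof (rule order_tendstoI)
    fix u
    assume "C / sqrt pi < u"
    then have "\<forall>\<^sub>F c in at_left 1. ?L / (sqrt c + 1) < u"
      using order_tendstoD(2)[OF filterlim_mono[OF lim_L order_refl at_le[of "{..<1}" UNIV]]] by auto
    moreover have "\<forall>\<^sub>F c in at_left 1. c \<in> {0<..<1::real}"
      by (rule eventually_at_leftI[of 0]) auto
    ultimately have "\<forall>\<^sub>F c in at_left 1. ?L / (sqrt c + 1) < u \<and> c \<in> {0<..<1}"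
      by (rule eventually_conj)
    from eventually_happens'[OF trivial_limit_at_left_real this]
    obtain c where c: "0 < c" "c < 1" "?L / (sqrt c + 1) < u"
      by auto
    have "c \<noteq> 1" using c by simp
    note lq = lim_q[OF c(1) this]
    show "\<forall>\<^sub>F N in sequentially. sqrt (real N) * a N < u"
      using order_tendstoD(2)[OF lq c(3)] eventually_gt_at_top[of 0]
    proof eventually_elim
      case (elim N)
      have m: "?m c N \<le> N"
        using c by (simp add: nat_le_iff floor_le_iff) (smt (verit) mult_left_le_one_le of_nat_0_le_iff)
      have "?S N = ?S (?m c N) + (\<Sum>n\<in>{?m c N<..N}. a n)"
        using m by (subst sum.union_disjoint[symmetric]) (auto intro!: sum.cong)
      moreover have "(\<Sum>n\<in>{?m c N<..N}. a n) \<ge> (\<Sum>n\<in>{?m c N<..N}. a N)"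
        using assms by (intro sum_mono) (auto simp: antimono_def)
      moreover have "(real N - c * real N) * a N \<le> (real N - real (?m c N)) * a N"
        using c by (intro mult_right_mono nonneg) (auto simp: of_nat_floor)
      ultimately have "real N * a N \<le> (?S N - ?S (?m c N)) / (1 - c)"
        using m c by (simp add: field_simps of_nat_diff)
      then have "sqrt (real N) * a N \<le> (?S N - ?S (?m c N)) / (1 - c) / sqrt (real N)"
        unfolding step by (intro divide_right_mono) auto
      also have "\<dots> = (?S (?m c N) / sqrt (real N) - ?S N / sqrt (real N)) / (c - 1)"
        using c elim by (simp add: field_simps)
      finally show ?case
        using elim by simp
    qed
  next
    fix u
    assume "u < C / sqrt pi"
    then have "\<forall>\<^sub>F c in at_right 1. u < ?L / (sqrt c + 1)"
      using order_tendstoD(1)[OF filterlim_mono[OF lim_L order_refl at_le[of "{1<..}" UNIV]]] by auto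
    then obtain c where c: "1 < c" "u < ?L / (sqrt c + 1)"
      using eventually_happens'[OF trivial_limit_at_right_real eventually_conj[OF _ eventually_at_right_less]] by blast
    have "0 < c" "c \<noteq> 1" using c by auto
    note lq = lim_q[OF this]
    show "\<forall>\<^sub>F N in sequentially. u < sqrt (real N) * a N"
      using order_tendstoD(1)[OF lq c(2)] eventually_gt_at_top[of 0]
    proof eventually_elim
      case (elim N)
      have m: "N \<le> ?m c N"
        using c mult_right_mono[of 1 c "real N"] by (intro le_nat_floor) auto
      have "?S (?m c N) = ?S N + (\<Sum>n\<in>{N<..?m c N}. a n)"
        using m by (subst sum.union_disjoint[symmetric]) (auto intro!: sum.cong)
      moreover have "(\<Sum>n\<in>{N<..?m c N}. a n) \<le> (\<Sum>n\<in>{N<..?m c N}. a N)"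
        using assms by (intro sum_mono) (auto simp: antimono_def)
      moreover have "(real (?m c N) - real N) * a N \<le> (c * real N - real N) * a N"
        using c by (intro mult_right_mono nonneg) (auto simp: of_nat_floor)
      ultimately have "(?S (?m c N) - ?S N) / (c - 1) \<le> real N * a N"
        using m c by (simp add: field_simps of_nat_diff)
      then have "(?S (?m c N) - ?S N) / (c - 1) / sqrt (real N) \<le> sqrt (real N) * a N"
        unfolding step by (intro divide_right_mono) auto
      moreover have "(?S (?m c N) - ?S N) / (c - 1) / sqrt (real N) = (?S (?m c N) / sqrt (real N) - ?S N / sqrt (real N)) / (c - 1)"
        using c elim by (simp add: field_simps)
      ultimately show ?case
        using elim by simp
    qed
  qed
qed

end

section \<open>Laplace transforms of summable sequences\<close>

definition laplace :: "(nat \<Rightarrow> real) \<Rightarrow> real \<Rightarrow> real" where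
  "laplace w x = (\<Sum>k. w k * exp (- (real k * x)))"

lemma in_N_D:
  assumes "in_N w"
  shows in_N_nonneg: "0 \<le> w k" and in_N_0: "w 0 = 0" and in_N_summable: "summable w"
  using assms by (auto simp: in_N_def)

lemma in_N_le_m0: "in_N w \<Longrightarrow> w k \<le> m0 w"
  using sum_le_suminf[of w "{k}"] by (auto simp: in_N_def m0_def)

lemma summable_laplace: "in_N w \<Longrightarrow> 0 \<le> x \<Longrightarrow> summable (\<lambda>k. w k * exp (- (real k * x)))"
  by (rule summable_comparison_test'[OF in_N_summable]) (auto simp: in_N_nonneg abs_mult intro!: mult_left_le)

lemma laplace_0: "laplace w 0 = m0 w"
  by (simp add: laplace_def m0_def)

lemma laplace_nonneg: "in_N w \<Longrightarrow> 0 \<le> x \<Longrightarrow> 0 \<le> laplace w x"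
  unfolding laplace_def by (intro suminf_nonneg summable_laplace) (auto simp: in_N_nonneg)

lemma laplace_le_m0: "in_N w \<Longrightarrow> 0 \<le> x \<Longrightarrow> laplace w x \<le> m0 w"
  unfolding laplace_def m0_def
  by (intro suminf_le summable_laplace) (auto simp: in_N_nonneg in_N_summable intro!: mult_left_le)

text \<open>The summable sequence \<open>w\<close> itself is a majorant on the closed half line, so
  continuity reaches \<open>x = 0\<close> even when the first moment is infinite.\<close>

lemma tendsto_laplace_0:
  assumes "in_N w"
  shows "(laplace w \<longlongrightarrow> m0 w) (at_right 0)"
proof -
  have "uniform_limit {0..} (\<lambda>n x. \<Sum>k<n. w k * exp (- (real k * x))) (laplace w) sequentially"
    unfolding laplace_def [abs_def]
    by (rule Weierstrass_m_test[where M = w])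
       (use assms in \<open>auto simp: in_N_nonneg in_N_summable abs_mult intro!: mult_left_le\<close>)
  then have "continuous_on {0..} (laplace w)"
    by (rule uniform_limit_theorem[rotated]) (auto intro!: continuous_intros always_eventually)
  then have "(laplace w \<longlongrightarrow> laplace w 0) (at 0 within {0..})"
    by (auto simp: continuous_on_def)
  then show ?thesis
    unfolding laplace_0 by (rule filterlim_mono) (auto intro: at_le)
qed

lemma summable_nat_exp: "0 < x \<Longrightarrow> summable (\<lambda>k. real k * exp (- (real k * x)))"
proof -
  assume "0 < x"
  then have "summable (\<lambda>n. real (Suc n) * exp (- x) ^ n)"
    using geometric_deriv_sums[of "exp (- x)"] by (auto simp: sums_iff)
  then have "summable (\<lambda>n. real n * exp (- x) ^ n)"
    by (rule summable_comparison_test') (auto simp: mult_right_mono)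
  then show ?thesis
    by (simp add: mult.commute flip: exp_of_nat_mult)
qed

text \<open>Averaging over the reflection \<open>i \<mapsto> k - i\<close> replaces the factor
  \<open>i\<close> by \<open>k / 2\<close>. This turns the gain term of the equations into a Cauchy
  product, the coefficient form of \<open>V * V_x\<close>.\<close>

lemma sum_index_convolution:
  fixes w :: "nat \<Rightarrow> real"
  shows "(\<Sum>i\<le>k. real i * w i * w (k - i)) = real k / 2 * (\<Sum>i\<le>k. w i * w (k - i))"
proof -
  have "(\<Sum>i\<le>k. real i * w i * w (k - i)) = (\<Sum>i\<le>k. real (k - i) * w (k - i) * w i)"
    by (rule sum.reindex_bij_witness[of _ "\<lambda>i. k - i" "\<lambda>i. k - i"]) auto
  also have "\<dots> = (\<Sum>i\<le>k. real k * (w i * w (k - i)) - real i * w i * w (k - i))"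
    by (intro sum.cong) (auto simp: of_nat_diff algebra_simps)
  finally show ?thesis
    by (simp add: sum_subtractf sum_distrib_left[symmetric])
qed

lemma convolution_inner:
  fixes w :: "nat \<Rightarrow> real"
  assumes "w 0 = 0"
  shows "(\<Sum>l=1..k-1. w l * w (k - l)) = (\<Sum>l\<le>k. w l * w (k - l))"
proof (rule sum.mono_neutral_left)
  show "\<forall>i\<in>{..k} - {1..k-1}. w i * w (k - i) = 0"
  proof
    fix i assume "i \<in> {..k} - {1..k-1}"
    then have "i = 0 \<or> i = k" by auto
    then show "w i * w (k - i) = 0" using assms by auto
  qed
qed auto

lemma convolution_bounds:
  assumes "in_N w"
  shows "0 \<le> (\<Sum>l\<le>k. w l * w (k - l))" "(\<Sum>l\<le>k. w l * w (k - l)) \<le> (m0 w)\<^sup>2"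
proof -
  show "0 \<le> (\<Sum>l\<le>k. w l * w (k - l))"
    using assms by (intro sum_nonneg mult_nonneg_nonneg) (auto simp: in_N_nonneg)
  have m: "0 \<le> m0 w"
    using in_N_le_m0[OF assms, of 0] in_N_0[OF assms] by simp
  have "(\<Sum>l\<le>k. w l * w (k - l)) \<le> (\<Sum>l\<le>k. w l * m0 w)"
    using assms by (intro sum_mono mult_left_mono) (auto simp: in_N_nonneg in_N_le_m0)
  also have "\<dots> \<le> m0 w * m0 w"
    unfolding sum_distrib_right[symmetric] using assms m
    by (intro mult_right_mono) (auto simp: m0_def in_N_nonneg in_N_summable intro!: sum_le_suminf)
  finally show "(\<Sum>l\<le>k. w l * w (k - l)) \<le> (m0 w)\<^sup>2"
    by (simp add: power2_eq_square)
qed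

text \<open>The first-order terms of the two factors cancel: the product lies between
  \<open>(1 - \<eta>) * (1 + \<eta>)\<close> and \<open>1\<close> once
  \<open>\<bar>\<eta>\<bar> \<le> 1\<close>, so it differs from \<open>1\<close> by a quantity
  quadratic in \<open>s - a\<close>.\<close>

lemma has_real_derivative_Lipschitz_exp:
  fixes \<eta> :: "real \<Rightarrow> real"
  assumes a: "a \<in> S" and L: "\<And>s. s \<in> S \<Longrightarrow> \<bar>\<eta> s\<bar> \<le> L * \<bar>s - a\<bar>"
  shows "((\<lambda>s. (1 - \<eta> s) * exp (\<eta> s)) has_real_derivative 0) (at a within S)"
proof -
  \<comment> \<open>Strictly positive, so that \<open>1 / M\<close> is a radius within which
    \<open>\<bar>\<eta> s\<bar> \<le> 1\<close>.\<close>
  define M where "M = \<bar>L\<bar> + 1"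
  have M: "0 < M" "\<And>s. s \<in> S \<Longrightarrow> \<bar>\<eta> s\<bar> \<le> M * \<bar>s - a\<bar>"
    using L by (auto simp: M_def intro!: order_trans[OF L mult_right_mono])
  have \<eta>a: "\<eta> a = 0"
    using L[OF a] by simp
  have "((\<lambda>s. ((1 - \<eta> s) * exp (\<eta> s) - 1) / (s - a)) \<longlongrightarrow> 0) (at a within S)"
  proof (rule Lim_null_comparison)
    show "((\<lambda>s. M\<^sup>2 * \<bar>s - a\<bar>) \<longlongrightarrow> 0) (at a within S)"
      by (rule tendsto_eq_intros refl | simp)+
    show "\<forall>\<^sub>F s in at a within S. norm (((1 - \<eta> s) * exp (\<eta> s) - 1) / (s - a)) \<le> M\<^sup>2 * \<bar>s - a\<bar>"
      unfolding eventually_at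
    proof (intro exI[of _ "1 / M"] conjI ballI impI)
      fix s assume s: "s \<in> S" "s \<noteq> a \<and> dist s a < 1 / M"
      then have small: "\<bar>\<eta> s\<bar> \<le> 1"
        using M(1) M(2)[OF s(1)] by (auto simp: dist_real_def field_simps)
      have "(1 - \<eta> s) * exp (\<eta> s) \<le> exp (- \<eta> s) * exp (\<eta> s)"
        using exp_ge_add_one_self[of "- \<eta> s"] by (intro mult_right_mono) auto
      moreover have "(1 - \<eta> s) * (1 + \<eta> s) \<le> (1 - \<eta> s) * exp (\<eta> s)"
        using exp_ge_add_one_self[of "\<eta> s"] small by (intro mult_left_mono) auto
      ultimately have "\<bar>(1 - \<eta> s) * exp (\<eta> s) - 1\<bar> \<le> \<bar>\<eta> s\<bar>\<^sup>2"
        by (simp add: exp_minus power2_eq_square algebra_simps)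
      also have "\<dots> \<le> (M * \<bar>s - a\<bar>)\<^sup>2"
        by (intro power_mono M s) auto
      finally show "norm (((1 - \<eta> s) * exp (\<eta> s) - 1) / (s - a)) \<le> M\<^sup>2 * \<bar>s - a\<bar>"
        using s by (auto simp: field_simps power2_eq_square)
    qed (use M in auto)
  qed
  then show ?thesis
    by (simp add: has_field_derivative_iff \<eta>a)
qed

text \<open>Backward uniqueness by an energy: the factor \<open>exp (2 * N * s)\<close> makes the
  weighted square \<open>G\<close> nondecreasing, and a nonnegative nondecreasing function that
  vanishes at \<open>t\<close> vanishes at \<open>0\<close>. Boundedness of \<open>B\<close>
  suffices, which suits a coefficient given by a series.\<close>

lemma linear_ode_zero:
  fixes f B :: "real \<Rightarrow> real"
  assumes "0 \<le> t" and f: "\<And>s. s \<in> {0..t} \<Longrightarrow> (f has_real_derivative f s * B s) (at s within {0..t})"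
    and B: "\<And>s. s \<in> {0..t} \<Longrightarrow> \<bar>B s\<bar> \<le> N" and "f t = 0"
  shows "f 0 = 0"
proof -
  define G where "G = (\<lambda>s. (f s)\<^sup>2 * exp (2 * N * s))"
  have G: "(G has_real_derivative 2 * (f s)\<^sup>2 * exp (2 * N * s) * (B s + N)) (at s within {0..t})" if "s \<in> {0..t}" for s
    unfolding G_def by (rule derivative_eq_intros f[OF that] refl)+ (simp add: algebra_simps power2_eq_square)
  have "((\<lambda>s. 2 * (f s)\<^sup>2 * exp (2 * N * s) * (B s + N)) has_integral G t - G 0) {0..t}"
    using G by (intro fundamental_theorem_of_calculus[OF \<open>0 \<le> t\<close>]) (simp add: has_real_derivative_iff_has_vector_derivative)
  then have "0 \<le> G t - G 0"
    by (rule has_integral_nonneg) (use B in \<open>fastforce simp: abs_le_iff\<close>)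
  then show ?thesis
    using \<open>f t = 0\<close> by (simp add: G_def)
qed

section \<open>Characteristics of the critical equations\<close>

locale critical =
  fixes v :: "real \<Rightarrow> nat \<Rightarrow> real"
  assumes sol: "crit_solution v"
begin

definition \<mu> :: "real \<Rightarrow> real" where
  "\<mu> t = integral {0..t} (\<lambda>s. m0 (v s))"

lemma in_N: "0 \<le> t \<Longrightarrow> in_N (v t)"
  and v_integral: "1 \<le> k \<Longrightarrow> 0 \<le> t \<Longrightarrow> v t k = v 0 k + integral {0..t} (\<lambda>s. crit_rhs (v s) k)"
  and rhs_integrable: "1 \<le> k \<Longrightarrow> 0 \<le> t \<Longrightarrow> (\<lambda>s. crit_rhs (v s) k) integrable_on {0..t}"
  using sol unfolding crit_solution_def by blast+

lemma m0_bounds: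
  assumes "0 \<le> t"
  shows m0_pos: "0 < m0 (v t)" and m0_le: "m0 (v t) \<le> m0 (v 0)"
proof -
  have "0 \<le> m0 (v 0) - m0 (v t) \<and> m0 (v 0) - m0 (v t) < m0 (v 0)"
    using sol assms unfolding crit_solution_def by blast
  then show "0 < m0 (v t)" "m0 (v t) \<le> m0 (v 0)"
    by auto
qed

lemma m0_antimono:
  assumes "0 \<le> s" "s \<le> t"
  shows "m0 (v t) \<le> m0 (v s)"
proof -
  have "mono_on {0..} (\<lambda>t. m0 (v 0) - m0 (v t))"
    using sol by (simp add: crit_solution_def)
  from mono_onD[OF this, of s t] show ?thesis
    using assms by simp
qed

lemma m0_integrable: "0 \<le> a \<Longrightarrow> (\<lambda>s. m0 (v s)) integrable_on {a..b}"
  using integrable_on_mono_on[of a b "\<lambda>s. - m0 (v s)"] m0_antimono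
  by (auto simp: mono_on_def dest: integrable_neg)

lemma \<mu>_diff: "0 \<le> a \<Longrightarrow> a \<le> b \<Longrightarrow> \<mu> b - \<mu> a = integral {a..b} (\<lambda>s. m0 (v s))"
  unfolding \<mu>_def using Henstock_Kurzweil_Integration.integral_combine[of 0 a b "\<lambda>s. m0 (v s)"] m0_integrable[of 0 b]
  by simp

lemma \<mu>_diff_bounds:
  assumes "0 \<le> a" "a \<le> b"
  shows "m0 (v b) * (b - a) \<le> \<mu> b - \<mu> a" "\<mu> b - \<mu> a \<le> m0 (v a) * (b - a)"
  using assms integral_le[of "\<lambda>_. m0 (v b)" "{a..b}" "\<lambda>s. m0 (v s)"] integral_le[of "\<lambda>s. m0 (v s)" "{a..b}" "\<lambda>_. m0 (v a)"]
  by (auto simp: \<mu>_diff m0_integrable m0_antimono mult.commute)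

lemma \<mu>_Lipschitz: "0 \<le> a \<Longrightarrow> 0 \<le> b \<Longrightarrow> \<bar>\<mu> b - \<mu> a\<bar> \<le> m0 (v 0) * \<bar>b - a\<bar>"
proof (induction a b rule: linorder_wlog)
  case (le a b)
  have "\<mu> b - \<mu> a \<le> m0 (v 0) * (b - a)"
    using le m0_le[of a] by (intro order_trans[OF \<mu>_diff_bounds(2)] mult_right_mono) auto
  moreover have "0 \<le> m0 (v b) * (b - a)"
    using le m0_pos[of b] by (intro mult_nonneg_nonneg) auto
  ultimately show ?case
    using \<mu>_diff_bounds(1)[of a b] le by auto
qed (simp add: abs_minus_commute)

lemma v_continuous: "continuous_on {0..T} (\<lambda>s. v s k)"
proof (cases "k = 0")
  case True
  show ?thesis
    by (rule continuous_on_eq[of _ "\<lambda>_. 0"]) (simp_all add: True in_N_0[OF in_N])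
next
  case k: False
  show ?thesis
  proof (cases "0 \<le> T")
    case True
    have "continuous_on {0..T} (\<lambda>s. v 0 k + integral {0..s} (\<lambda>s. crit_rhs (v s) k))"
      using k True by (intro continuous_intros indefinite_integral_continuous_1 rhs_integrable) auto
    then show ?thesis
      by (rule continuous_on_eq) (use k in \<open>auto intro!: v_integral[symmetric]\<close>)
  qed auto
qed

lemma v_le: "0 \<le> s \<Longrightarrow> v s k \<le> m0 (v 0)"
  using in_N_le_m0[OF in_N] m0_le order_trans by blast

text \<open>\<open>\<mu>\<close> need not be differentiable, as \<open>m0 (v s)\<close> is not known to be continuous. But
  \<open>v s k + k * v a k * \<mu> s\<close> is differentiable at \<open>a\<close>, and what remains of the product is a function of
  \<open>\<mu> s - \<mu> a\<close> with vanishing derivative at \<open>0\<close>.\<close>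

lemma integrating_factor_derivative:
  assumes a: "a \<in> {0..T}"
  shows "((\<lambda>s. v s k * exp (real k * \<mu> s)) has_real_derivative
           real k / 2 * (\<Sum>l\<le>k. v a l * v a (k - l)) * exp (real k * \<mu> a)) (at a within {0..T})"
proof (cases "k = 0")
  case True
  have "((\<lambda>s. 0) has_real_derivative 0) (at a within {0..T})"
    by simp
  then have "((\<lambda>s. v s k * exp (real k * \<mu> s)) has_real_derivative 0) (at a within {0..T})"
    by (rule has_field_derivative_transform_within[OF _ zero_less_one a]) (simp add: True in_N_0[OF in_N])
  then show ?thesis
    by (simp add: True)
next
  case False
  then have k: "1 \<le> k" by simp
  have T: "0 \<le> T" using a by auto
  define c where "c = (\<lambda>s. \<Sum>l\<le>k. v s l * v s (k - l))"
  \<comment> \<open>The integrand of \<open>v s k + real k * v a k * \<mu> s\<close>. The possibly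
    discontinuous \<open>m0 (v r)\<close> is multiplied by \<open>v r k - v a k\<close>, which tends
    to \<open>0\<close> at \<open>a\<close>; so \<open>g\<close> is continuous at \<open>a\<close>
    and its integral differentiable there.\<close>
  define g where "g = (\<lambda>r. real k / 2 * c r - real k * (v r k - v a k) * m0 (v r))"
  define P where "P = (\<lambda>s. v 0 k - real k * v a k * \<mu> a + integral {0..s} g)"
  define \<eta> where "\<eta> = (\<lambda>s. real k * (\<mu> s - \<mu> a))"
  have rhs: "crit_rhs (v s) k = real k / 2 * c s - real k * v s k * m0 (v s)" if "0 \<le> s" for s
    unfolding crit_rhs_def c_def using convolution_inner[of "v s" k] in_N_0[OF in_N[OF that]] by simp
  have g_int: "(g has_integral (v s k - v 0 k + real k * v a k * \<mu> s)) {0..s}" if "s \<in> {0..T}" for s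
  proof -
    have "((\<lambda>r. crit_rhs (v r) k + real k * v a k * m0 (v r)) has_integral
        (integral {0..s} (\<lambda>r. crit_rhs (v r) k) + real k * v a k * \<mu> s)) {0..s}"
      unfolding \<mu>_def using that k
      by (intro has_integral_add has_integral_mult_right integrable_integral rhs_integrable m0_integrable) auto
    moreover have "integral {0..s} (\<lambda>r. crit_rhs (v r) k) = v s k - v 0 k"
      using v_integral[of k s] that k by simp
    ultimately have "((\<lambda>r. crit_rhs (v r) k + real k * v a k * m0 (v r)) has_integral
        (v s k - v 0 k + real k * v a k * \<mu> s)) {0..s}"
      by simp
    then show ?thesis
      by (rule has_integral_eq[rotated]) (auto simp: rhs g_def algebra_simps)
  qed
  have vP: "v s k = P s - v a k * \<eta> s" if "s \<in> {0..T}" for s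
    using integral_unique[OF g_int[OF that]] by (simp add: P_def \<eta>_def algebra_simps)
  have "(g \<longlongrightarrow> g a) (at a within {0..T})"
  proof -
    have cv: "((\<lambda>s. v s j) \<longlongrightarrow> v a j) (at a within {0..T})" for j
      using v_continuous[of T j] a by (auto simp: continuous_on_def)
    have z: "((\<lambda>r. real k * (v r k - v a k) * m0 (v r)) \<longlongrightarrow> 0) (at a within {0..T})"
    proof (rule Lim_null_comparison)
      show "((\<lambda>r. real k * \<bar>v r k - v a k\<bar> * m0 (v 0)) \<longlongrightarrow> 0) (at a within {0..T})"
        by (rule tendsto_eq_intros cv refl | simp)+
      show "\<forall>\<^sub>F r in at a within {0..T}. norm (real k * (v r k - v a k) * m0 (v r)) \<le> real k * \<bar>v r k - v a k\<bar> * m0 (v 0)"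
        unfolding eventually_at_filter
        by (rule always_eventually) (auto simp: abs_mult m0_le m0_pos less_imp_le intro!: mult_left_mono)
    qed
    have "((\<lambda>r. real k / 2 * c r) \<longlongrightarrow> real k / 2 * c a) (at a within {0..T})"
      unfolding c_def by (intro tendsto_intros cv)
    from tendsto_diff[OF this z] show ?thesis
      by (simp add: g_def)
  qed
  then have "((\<lambda>s. integral {0..s} g) has_vector_derivative g a) (at a within {0..T} - {})"
    using g_int[of T] a T by (intro integral_has_vector_derivative_continuous_at) (auto simp: continuous_within)
  then have P': "(P has_real_derivative g a) (at a within {0..T})"
    unfolding P_def has_real_derivative_iff_has_vector_derivative
    by (auto intro!: derivative_eq_intros)
  have \<eta>L: "\<bar>\<eta> s\<bar> \<le> real k * m0 (v 0) * \<bar>s - a\<bar>" if "s \<in> {0..T}" for s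
    using mult_left_mono[OF \<mu>_Lipschitz[of a s], of "real k"] a that by (auto simp: \<eta>_def abs_mult mult.assoc)
  have \<eta>a: "\<eta> a = 0" by (simp add: \<eta>_def)
  have Pa: "P a = v a k" using vP[OF a] \<eta>a by simp
  \<comment> \<open>Up to the constant \<open>exp (real k * \<mu> a)\<close>, the product splits
    into \<open>(P s - P a) * exp (\<eta> s)\<close> and
    \<open>v a k * ((1 - \<eta> s) * exp (\<eta> s))\<close>. In the first summand the factor
    \<open>P s - P a\<close> vanishes at \<open>a\<close>, so the limit
    \<open>exp (\<eta> s) \<rightarrow> 1\<close> is enough.\<close>
  have "((\<lambda>s. (P s - P a) * exp (\<eta> s)) has_real_derivative g a) (at a within {0..T})"
  proof -
    have "((\<lambda>s. exp (\<eta> s)) \<longlongrightarrow> exp 0) (at a within {0..T})"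
    proof (rule tendsto_exp, rule Lim_null_comparison)
      show "((\<lambda>s. real k * m0 (v 0) * \<bar>s - a\<bar>) \<longlongrightarrow> 0) (at a within {0..T})"
        by (rule tendsto_eq_intros refl | simp)+
      show "\<forall>\<^sub>F s in at a within {0..T}. norm (\<eta> s) \<le> real k * m0 (v 0) * \<bar>s - a\<bar>"
        using \<eta>L by (auto simp: eventually_at_filter)
    qed
    from tendsto_mult[OF P'[unfolded has_field_derivative_iff] this] show ?thesis
      by (simp add: has_field_derivative_iff)
  qed
  moreover have "((\<lambda>s. v a k * ((1 - \<eta> s) * exp (\<eta> s))) has_real_derivative v a k * 0) (at a within {0..T})"
    by (intro DERIV_cmult has_real_derivative_Lipschitz_exp[OF a \<eta>L])
  ultimately have "((\<lambda>s. ((P s - P a) * exp (\<eta> s) + v a k * ((1 - \<eta> s) * exp (\<eta> s))) * exp (real k * \<mu> a)) has_real_derivative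
      (g a + v a k * 0) * exp (real k * \<mu> a)) (at a within {0..T})"
    by (intro DERIV_cmult_right DERIV_add)
  then have "((\<lambda>s. v s k * exp (real k * \<mu> s)) has_real_derivative (g a + v a k * 0) * exp (real k * \<mu> a)) (at a within {0..T})"
  proof (rule has_field_derivative_transform_within[OF _ zero_less_one a])
    fix s assume s: "s \<in> {0..T}"
    have "exp (real k * \<mu> s) = exp (\<eta> s) * exp (real k * \<mu> a)"
      by (simp add: \<eta>_def algebra_simps flip: exp_add)
    then show "((P s - P a) * exp (\<eta> s) + v a k * ((1 - \<eta> s) * exp (\<eta> s))) * exp (real k * \<mu> a) = v s k * exp (real k * \<mu> s)"
      by (simp add: vP[OF s] Pa algebra_simps)
  qed
  then show ?thesis
    by (simp add: g_def c_def)
qed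

text \<open>Followed backwards from \<open>(t, x)\<close>, the characteristic \<open>X\<close> stays above \<open>x\<close> because \<open>m0 (v s)\<close>
  is at least \<open>m0 (v t) \<ge> w\<close>; so it never meets the boundary \<open>x = 0\<close>.\<close>

lemma characteristic:
  assumes t: "0 \<le> t" and x: "0 < x"
  defines "w \<equiv> laplace (v t) x"
  shows "laplace (v 0) (x + \<mu> t - t * w) = w"
proof -
  \<comment> \<open>Formally \<open>X t = x\<close> and \<open>X' = w - m0 (v s)\<close>: the
    characteristic speed is \<open>V - m0\<close>, with \<open>V\<close> frozen at the constant
    value \<open>w\<close> it is expected to keep. Writing \<open>X\<close> through
    \<open>\<mu>\<close> avoids differentiating it.\<close>
  define X where "X = (\<lambda>s. x + \<mu> t - (t - s) * w - \<mu> s)"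
  define M where "M = m0 (v 0)"
  define e where "e = (\<lambda>k s. v s k * exp (- (real k * X s)))"
  \<comment> \<open>The derivative of \<open>e k\<close>. The loss term
    \<open>real k * v s k * m0 (v s)\<close> is absorbed by the factor
    \<open>exp (real k * \<mu> s)\<close> inside \<open>e\<close>, leaving the constant
    \<open>w\<close> in place of \<open>m0 (v s)\<close>.\<close>
  define d where "d = (\<lambda>k s. exp (- (real k * X s)) * (real k / 2 * (\<Sum>l\<le>k. v s l * v s (k - l)) - real k * w * v s k))"
  have w: "0 \<le> w" "w \<le> m0 (v t)"
    using laplace_nonneg[OF in_N[OF t], of x] laplace_le_m0[OF in_N[OF t], of x] x by (auto simp: w_def)
  have M: "0 < M" "w \<le> M"
    using w(2) m0_le[OF t] m0_pos[of 0] by (auto simp: M_def)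
  have X_ge: "x \<le> X s" if "s \<in> {0..t}" for s
  proof -
    have "(t - s) * w \<le> m0 (v t) * (t - s)"
      using w that by (simp add: mult.commute mult_right_mono)
    then show ?thesis
      using \<mu>_diff_bounds(1)[of s t] that by (simp add: X_def)
  qed
  have e': "(e k has_real_derivative d k s) (at s within {0..t})" if s: "s \<in> {0..t}" for k s
  proof -
    have "((\<lambda>s. exp (- (real k * (x + \<mu> t - (t - s) * w)))) has_real_derivative
        exp (- (real k * (x + \<mu> t - (t - s) * w))) * - (real k * w)) (at s within {0..t})"
      by (auto intro!: derivative_eq_intros simp: algebra_simps)
    from DERIV_mult[OF integrating_factor_derivative[OF s, of k] this]
    have "((\<lambda>s. v s k * exp (real k * \<mu> s) * exp (- (real k * (x + \<mu> t - (t - s) * w)))) has_real_derivative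
        exp (real k * \<mu> s) * exp (- (real k * (x + \<mu> t - (t - s) * w))) *
        (real k / 2 * (\<Sum>l\<le>k. v s l * v s (k - l)) - real k * w * v s k)) (at s within {0..t})"
      by (simp add: algebra_simps)
    moreover have "exp (real k * \<mu> s) * exp (- (real k * (x + \<mu> t - (t - s) * w))) = exp (- (real k * X s))"
      by (simp add: X_def algebra_simps flip: exp_add)
    ultimately have "((\<lambda>s. v s k * exp (real k * \<mu> s) * exp (- (real k * (x + \<mu> t - (t - s) * w)))) has_real_derivative d k s) (at s within {0..t})"
      by (simp only: d_def)
    moreover have "(\<lambda>s. v s k * exp (real k * \<mu> s) * exp (- (real k * (x + \<mu> t - (t - s) * w)))) = e k"
      by (auto simp: e_def X_def algebra_simps simp flip: exp_add)
    ultimately show ?thesis by simp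
  qed
  have exp_X: "exp (- (real k * X s)) \<le> exp (- (real k * x))" if "s \<in> {0..t}" for k s
    using X_ge[OF that] by (simp add: mult_left_mono)
  have d_bound: "norm (d k s) \<le> 2 * M\<^sup>2 * (real k * exp (- (real k * x)))" if s: "s \<in> {0..t}" for k s
  proof -
    have N: "in_N (v s)" using s in_N by auto
    have conv: "\<bar>\<Sum>l\<le>k. v s l * v s (k - l)\<bar> \<le> M\<^sup>2"
      using convolution_bounds[OF N, of k] m0_le[of s] m0_pos[of s] s
      by (auto simp: M_def intro: order_trans[OF _ power_mono])
    have "\<bar>w * v s k\<bar> \<le> M * M"
      using w M v_le[of s k] in_N_nonneg[OF N, of k] s by (simp add: abs_mult M_def mult_mono)
    with conv have "real k * \<bar>(\<Sum>l\<le>k. v s l * v s (k - l)) / 2 - w * v s k\<bar> \<le> real k * (2 * M\<^sup>2)"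
      by (intro mult_left_mono) (auto simp: power2_eq_square)
    moreover have "real k / 2 * (\<Sum>l\<le>k. v s l * v s (k - l)) - real k * w * v s k
        = real k * ((\<Sum>l\<le>k. v s l * v s (k - l)) / 2 - w * v s k)"
      by (simp add: algebra_simps)
    ultimately have "\<bar>real k / 2 * (\<Sum>l\<le>k. v s l * v s (k - l)) - real k * w * v s k\<bar> \<le> real k * (2 * M\<^sup>2)"
      by (simp add: abs_mult)
    then have "exp (- (real k * X s)) * \<bar>real k / 2 * (\<Sum>l\<le>k. v s l * v s (k - l)) - real k * w * v s k\<bar>
        \<le> exp (- (real k * x)) * (real k * (2 * M\<^sup>2))"
      using exp_X[OF s] by (intro mult_mono) auto
    then show ?thesis
      by (simp add: d_def abs_mult mult_ac)
  qed
  have "uniform_limit {0..t} (\<lambda>n s. \<Sum>i<n. d i s) (\<lambda>s. \<Sum>i. d i s) sequentially"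
    by (rule Weierstrass_m_test[OF d_bound]) (auto intro!: summable_mult summable_nat_exp x)
  then have "\<exists>g. \<forall>s\<in>{0..t}. (\<lambda>k. e k s) sums g s \<and> (g has_field_derivative (\<Sum>i. d i s)) (at s within {0..t})"
  proof (rule has_field_derivative_series[rotated 2])
    show "summable (\<lambda>k. e k t)"
      using summable_laplace[OF in_N[OF t], of x] x by (simp add: e_def X_def)
  qed (use e' t in auto)
  then obtain g where g: "\<And>s. s \<in> {0..t} \<Longrightarrow> (\<lambda>k. e k s) sums g s"
      "\<And>s. s \<in> {0..t} \<Longrightarrow> (g has_real_derivative (\<Sum>i. d i s)) (at s within {0..t})"
    by blast
  have g_eq: "g s = laplace (v s) (X s)" if "s \<in> {0..t}" for s
    using sums_unique[OF g(1)[OF that]] by (simp add: laplace_def e_def)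
  define B where "B = (\<lambda>s. \<Sum>k. real k * e k s)"
  have e_bound: "norm (real k * e k s) \<le> M * (real k * exp (- (real k * x)))" if s: "s \<in> {0..t}" for k s
  proof -
    have "v s k * exp (- (real k * X s)) \<le> M * exp (- (real k * x))"
      using s M v_le[of s k] exp_X[OF s] by (intro mult_mono) (auto simp: M_def)
    then show ?thesis
      using s in_N_nonneg[OF in_N, of s k] mult_left_mono[of _ _ "real k"]
      by (fastforce simp: e_def abs_mult mult.left_commute)
  qed
  \<comment> \<open>Here \<open>B s\<close> is \<open>- V_x(s, X s)\<close>. The gain term sums to
    \<open>B s * g s\<close> by the Cauchy product and the rest to \<open>w * B s\<close>, so
    \<open>g - w\<close> solves a homogeneous linear equation. It vanishes at \<open>t\<close> by
    the choice of \<open>w\<close>, hence also at \<open>0\<close>.\<close>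
  have sum_d: "(\<Sum>i. d i s) = (g s - w) * B s" if s: "s \<in> {0..t}" for s
  proof -
    have e_nonneg: "0 \<le> e k s" for k
      using s in_N_nonneg[OF in_N, of s k] by (simp add: e_def)
    have s1: "summable (\<lambda>k. e k s)" using g(1)[OF s] by (rule sums_summable)
    have s2: "summable (\<lambda>k. real k * e k s)"
      by (rule summable_comparison_test'[OF summable_mult[OF summable_nat_exp[OF x]] e_bound[OF s]])
    have cp: "(\<lambda>k. \<Sum>i\<le>k. (real i * e i s) * e (k - i) s) sums (B s * g s)"
      using Cauchy_product_sums[of "\<lambda>k. real k * e k s" "\<lambda>k. e k s"] s1 s2 e_nonneg sums_unique[OF g(1)[OF s]]
      by (simp add: B_def)
    have "(\<lambda>k. (\<Sum>i\<le>k. (real i * e i s) * e (k - i) s) - w * (real k * e k s)) sums (B s * g s - w * B s)"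
      unfolding B_def by (intro sums_diff sums_mult summable_sums s2 cp[unfolded B_def])
    moreover have "(\<Sum>i\<le>k. (real i * e i s) * e (k - i) s) - w * (real k * e k s) = d k s" for k
    proof -
      have "(\<Sum>i\<le>k. (real i * e i s) * e (k - i) s) = (\<Sum>i\<le>k. exp (- (real k * X s)) * (real i * v s i * v s (k - i)))"
      proof (intro sum.cong refl)
        fix i assume "i \<in> {..k}"
        then have "exp (- (real i * X s)) * exp (- (real (k - i) * X s)) = exp (- (real k * X s))"
          by (simp add: of_nat_diff algebra_simps flip: exp_add)
        then have "(real i * v s i * v s (k - i)) * (exp (- (real i * X s)) * exp (- (real (k - i) * X s)))
            = (real i * v s i * v s (k - i)) * exp (- (real k * X s))"
          by (rule arg_cong)
        then show "(real i * e i s) * e (k - i) s = exp (- (real k * X s)) * (real i * v s i * v s (k - i))"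
          by (simp only: e_def mult_ac)
      qed
      also have "\<dots> = exp (- (real k * X s)) * (real k / 2 * (\<Sum>i\<le>k. v s i * v s (k - i)))"
        by (simp only: sum_distrib_left[symmetric] sum_index_convolution)
      finally have "(\<Sum>i\<le>k. (real i * e i s) * e (k - i) s) = exp (- (real k * X s)) * (real k / 2 * (\<Sum>i\<le>k. v s i * v s (k - i)))" .
      then show ?thesis
        by (simp only: d_def e_def right_diff_distrib mult_ac)
    qed
    ultimately have "(\<lambda>k. d k s) sums (B s * g s - w * B s)"
      by simp
    then show ?thesis
      by (simp add: sums_unique[symmetric] algebra_simps)
  qed
  have "g 0 - w = 0"
  proof (rule linear_ode_zero[OF t, of "\<lambda>s. g s - w" B])
    show "((\<lambda>s. g s - w) has_real_derivative (g s - w) * B s) (at s within {0..t})" if "s \<in> {0..t}" for s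
      using g(2)[OF that] unfolding sum_d[OF that] by (auto intro!: derivative_eq_intros)
    show "\<bar>B s\<bar> \<le> (\<Sum>k. M * (real k * exp (- (real k * x))))" if "s \<in> {0..t}" for s
      using norm_suminf_le[OF e_bound[OF that] summable_mult[OF summable_nat_exp[OF x]]] by (simp add: B_def)
    show "g t - w = 0"
      using g_eq[of t] t by (simp add: X_def w_def)
  qed
  then show ?thesis
    using g_eq[of 0] t by (simp add: X_def \<mu>_def)
qed

end

section \<open>Gelation\<close>

lemma tendsto_exp_second_order:
  "((\<lambda>h. (exp (- (c * h)) - 1 + c * h) / h\<^sup>2) \<longlongrightarrow> c\<^sup>2 / 2) (at (0::real))"
proof (cases "c = 0")
  case False
  have base: "((\<lambda>z::real. (exp (- z) - 1 + z) / z\<^sup>2) \<longlongrightarrow> 1 / 2) (at 0)"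
    by real_asymp
  have f: "filterlim (\<lambda>h. c * h) (at 0) (at 0)"
    using False by (auto simp: filterlim_at eventually_at_filter intro!: tendsto_eq_intros)
  have "((\<lambda>h. c\<^sup>2 * ((exp (- (c * h)) - 1 + c * h) / (c * h)\<^sup>2)) \<longlongrightarrow> c\<^sup>2 * (1 / 2)) (at 0)"
    by (intro tendsto_mult tendsto_const filterlim_compose[OF base f])
  then show ?thesis
    using False by (simp add: power_mult_distrib)
qed simp

section \<open>Derivatives of the initial Laplace transform and their inverse\<close>

locale critical_finite = critical +
  assumes init: "in_Nstar (v 0)"
begin

declare One_nat_def [simp del]

text \<open>Up to the sign \<open>(- 1) ^ j\<close> this is the \<open>j\<close>-th derivative of
  \<open>laplace (v 0)\<close> at \<open>y\<close>. Summing over the finite support gives it a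
  meaning for negative \<open>y\<close> too.\<close>

definition moment :: "nat \<Rightarrow> real \<Rightarrow> real" where
  "moment j y = (\<Sum>k | v 0 k \<noteq> 0. real k ^ j * v 0 k * exp (- (real k * y)))"

lemma finite_support: "finite {k. v 0 k \<noteq> 0}"
  using init by (simp add: in_Nstar_def)

lemma support_pos: "v 0 k \<noteq> 0 \<Longrightarrow> 1 \<le> k \<and> 0 < v 0 k"
  using in_N_0[OF in_N[of 0]] in_N_nonneg[OF in_N[of 0], of k] by (cases k) auto

lemma support_nonempty: "{k. v 0 k \<noteq> 0} \<noteq> {}"
proof
  assume "{k. v 0 k \<noteq> 0} = {}"
  then have "v 0 = (\<lambda>_. 0)"
    by auto
  then show False
    using m0_pos[of 0] by (simp add: m0_def)
qed

lemma laplace_eq_moment: "laplace (v 0) y = moment 0 y"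
  unfolding laplace_def moment_def using finite_support by (subst suminf_finite) auto

lemma moment_0_0: "moment 0 0 = m0 (v 0)"
  using laplace_eq_moment[of 0] by (simp add: laplace_0)

lemma m1_initial: "m1 (v 0) = ereal (moment 1 0)"
proof -
  have "m1 (v 0) = (\<Sum>k | v 0 k \<noteq> 0. ereal (real k * v 0 k))"
    unfolding m1_def using finite_support by (subst suminf_finite) (auto simp: zero_ereal_def)
  then show ?thesis
    by (simp add: moment_def)
qed

lemma moment_pos: "0 < moment j y"
  unfolding moment_def
proof (rule sum_pos[OF finite_support support_nonempty])
  show "0 < real k ^ j * v 0 k * exp (- (real k * y))" if "k \<in> {k. v 0 k \<noteq> 0}" for k
    using support_pos[of k] that by simp
qed

lemma moment_deriv: "(moment j has_real_derivative - moment (j + 1) y) (at y within S)"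
  unfolding moment_def [abs_def] sum_negf[symmetric]
  by (rule DERIV_sum) (auto intro!: derivative_eq_intros simp: power_add mult_ac)

lemma isCont_moment: "isCont (moment j) y"
  using moment_deriv[of j y UNIV] by (rule DERIV_isCont)

lemma moment_strict_antimono: "x < y \<Longrightarrow> moment j y < moment j x"
  by (rule DERIV_neg_imp_decreasing) (auto intro!: moment_deriv moment_pos)

lemma moment_antimono: "x \<le> y \<Longrightarrow> moment j y \<le> moment j x"
  using moment_strict_antimono[of x y j] by (cases "x = y") auto

lemma moment_less_iff: "moment j x < moment j y \<longleftrightarrow> y < x"
  using moment_strict_antimono[of y x j] moment_antimono[of x y j] by linarith

lemma moment_le_iff: "moment j x \<le> moment j y \<longleftrightarrow> y \<le> x"
  using moment_less_iff[of j y x] by linarith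

lemma moment_inj: "moment j x = moment j y \<Longrightarrow> x = y"
  using moment_less_iff[of j x y] moment_less_iff[of j y x] by linarith

text \<open>All indices in the support are at least \<open>1\<close>, so each
  \<open>exp (- (real k * y))\<close> compares with \<open>exp (- y)\<close>. The bounds force every
  value in \<open>(0, \<infinity>)\<close> to be attained.\<close>

lemma moment_le_exp: "0 \<le> y \<Longrightarrow> moment j y \<le> exp (- y) * moment j 0"
  and moment_ge_exp: "y \<le> 0 \<Longrightarrow> exp (- y) * moment j 0 \<le> moment j y"
proof -
  have e: "exp (- y) * moment j 0 = (\<Sum>k | v 0 k \<noteq> 0. real k ^ j * v 0 k * exp (- y))"
    by (simp add: moment_def sum_distrib_left mult_ac)
  show "moment j y \<le> exp (- y) * moment j 0" if "0 \<le> y"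
    unfolding e unfolding moment_def
  proof (intro sum_mono mult_left_mono)
    fix k assume k: "k \<in> {k. v 0 k \<noteq> 0}"
    show "exp (- (real k * y)) \<le> exp (- y)"
      using support_pos[of k] k that mult_right_mono[of 1 "real k" y] by auto
    show "0 \<le> real k ^ j * v 0 k"
      using support_pos[of k] k by auto
  qed
  show "exp (- y) * moment j 0 \<le> moment j y" if "y \<le> 0"
    unfolding e unfolding moment_def
  proof (intro sum_mono mult_left_mono)
    fix k assume k: "k \<in> {k. v 0 k \<noteq> 0}"
    show "exp (- y) \<le> exp (- (real k * y))"
      using support_pos[of k] k that mult_right_mono_neg[of 1 "real k" y] by auto
    show "0 \<le> real k ^ j * v 0 k"
      using support_pos[of k] k by auto
  qed
qed

lemma moment_surj:
  assumes "0 < c"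
  obtains y where "moment j y = c"
proof (cases "c \<le> moment j 0")
  case True
  \<comment> \<open>The point where the exponential bound takes exactly the value \<open>c\<close>;
    the intermediate value theorem then applies between it and \<open>0\<close>.\<close>
  define y where "y = ln (moment j 0 / c)"
  have "0 \<le> y" "exp (- y) * moment j 0 = c"
    using True assms moment_pos[of j 0] by (auto simp: y_def exp_minus)
  then have "moment j y \<le> c"
    using moment_le_exp[of y j] by simp
  then have "\<exists>x\<ge>0. x \<le> y \<and> moment j x = c"
    using True \<open>0 \<le> y\<close> isCont_moment by (intro IVT2) auto
  then show ?thesis
    using that by blast
next
  case False
  define y where "y = ln (moment j 0 / c)"
  have "y \<le> 0" "exp (- y) * moment j 0 = c"
    using False assms moment_pos[of j 0] by (auto simp: y_def exp_minus)
  then have "c \<le> moment j y"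
    using moment_ge_exp[of y j] by simp
  then have "\<exists>x\<ge>y. x \<le> 0 \<and> moment j x = c"
    using False \<open>y \<le> 0\<close> isCont_moment by (intro IVT2) auto
  then show ?thesis
    using that by blast
qed

text \<open>The critical point of \<open>y + t * moment 0 y\<close> on the whole real line. It is
  negative before gelation and \<open>0\<close> at gelation, so it is differentiable on both sides
  of that time.\<close>

definition ystar :: "real \<Rightarrow> real" where
  "ystar t = (THE y. moment 1 y = 1 / t)"

lemma moment_ystar: "0 < t \<Longrightarrow> moment 1 (ystar t) = 1 / t"
proof -
  assume "0 < t"
  then obtain y where "moment 1 y = 1 / t"
    using moment_surj[of "1 / t" 1] by auto
  then show ?thesis
    unfolding ystar_def by (rule theI) (metis \<open>moment 1 y = 1 / t\<close> moment_inj)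
qed

lemma ystar_inverse: "ystar (1 / moment 1 y) = y"
  using moment_ystar[of "1 / moment 1 y"] moment_pos[of 1 y] by (auto intro: moment_inj)

text \<open>\<open>ystar\<close> inverts \<open>y \<mapsto> 1 / moment 1 y\<close>, whose derivative
  \<open>moment 2 y / (moment 1 y)\<twosuperior>\<close> equals
  \<open>t\<twosuperior> * moment 2 y\<close> at \<open>y = ystar t\<close>.\<close>

lemma ystar_deriv:
  assumes "0 < t"
  shows "(ystar has_real_derivative 1 / (t\<^sup>2 * moment 2 (ystar t))) (at t within S)"
proof -
  have nz: "moment 1 z \<noteq> 0" for z
    using moment_pos[of 1 z] by simp
  have d: "((\<lambda>y. 1 / moment 1 y) has_real_derivative t\<^sup>2 * moment 2 (ystar t)) (at (ystar t))"
  proof -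
    have "((\<lambda>y. 1 / moment 1 y) has_real_derivative
        (0 * moment 1 (ystar t) - 1 * - moment (1 + 1) (ystar t)) / (moment 1 (ystar t) * moment 1 (ystar t))) (at (ystar t))"
      by (intro DERIV_divide DERIV_const moment_deriv nz)
    then show ?thesis
      using assms by (simp add: moment_ystar power2_eq_square mult_ac)
  qed
  have c: "isCont ystar (1 / moment 1 (ystar t))"
    by (rule isCont_inverse_function[of 1 _ ystar "\<lambda>y. 1 / moment 1 y"])
       (auto simp: ystar_inverse nz intro!: continuous_intros isCont_moment)
  have "(ystar has_real_derivative inverse (t\<^sup>2 * moment 2 (ystar t))) (at t)"
  proof (rule DERIV_inverse_function[where f = "\<lambda>y. 1 / moment 1 y" and g = ystar and x = t and a = 0 and b = "t + 1", OF d])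
    show "t\<^sup>2 * moment 2 (ystar t) \<noteq> 0"
      using assms moment_pos[of 2 "ystar t"] by simp
    show "0 < t" "t < t + 1"
      using assms by auto
    show "1 / moment 1 (ystar y) = y" if "0 < y" "y < t + 1" for y
      using that by (simp add: moment_ystar)
    show "isCont ystar t"
      using c assms by (simp add: moment_ystar)
  qed
  then show ?thesis
    by (auto simp: inverse_eq_divide intro: has_field_derivative_at_within)
qed

section \<open>Locating the foot of the characteristic before and after gelation\<close>

text \<open>The starting point of the characteristic that reaches \<open>x = 0\<close> at time \<open>t\<close>.\<close>

definition foot :: "real \<Rightarrow> real" where
  "foot t = \<mu> t - t * m0 (v t)"

lemma foot_nonneg: "0 \<le> t \<Longrightarrow> 0 \<le> foot t"
  using \<mu>_diff_bounds(1)[of 0 t] by (simp add: foot_def \<mu>_def mult.commute)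

text \<open>Let \<open>x\<close> tend to \<open>0\<close> from the right in
  \<open>characteristic\<close>: \<open>laplace (v t) x\<close> tends to \<open>m0 (v t)\<close> and
  the starting point to \<open>foot t\<close>.\<close>

lemma moment_foot:
  assumes "0 \<le> t"
  shows "moment 0 (foot t) = m0 (v t)"
proof (rule tendsto_unique)
  have L: "(laplace (v t) \<longlongrightarrow> m0 (v t)) (at_right 0)"
    using in_N[OF assms] by (rule tendsto_laplace_0)
  then show "(laplace (v t) \<longlongrightarrow> m0 (v t)) (at_right 0)" .
  have "((\<lambda>x. x + \<mu> t - t * laplace (v t) x) \<longlongrightarrow> 0 + \<mu> t - t * m0 (v t)) (at_right 0)"
    by (intro tendsto_intros L)
  then have "((\<lambda>x. moment 0 (x + \<mu> t - t * laplace (v t) x)) \<longlongrightarrow> moment 0 (foot t)) (at_right 0)"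
    by (intro isCont_tendsto_compose[OF isCont_moment]) (simp add: foot_def)
  moreover have "\<forall>\<^sub>F x in at_right 0. moment 0 (x + \<mu> t - t * laplace (v t) x) = laplace (v t) x"
    using eventually_at_right_less[of 0]
    by eventually_elim (use characteristic[OF assms] in \<open>simp add: laplace_eq_moment\<close>)
  ultimately show "(laplace (v t) \<longlongrightarrow> moment 0 (foot t)) (at_right 0)"
    by (rule Lim_transform_eventually)
qed simp

text \<open>Its size near \<open>x = 0\<close> detects gelation: linear in \<open>x\<close> when the
  first moment is finite, of order \<open>sqrt x\<close> afterwards.\<close>

definition defect :: "real \<Rightarrow> real \<Rightarrow> real" where
  "defect t x = m0 (v t) - laplace (v t) x"

lemma defect_nonneg: "0 \<le> t \<Longrightarrow> 0 \<le> x \<Longrightarrow> 0 \<le> defect t x"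
  using laplace_le_m0[OF in_N] by (simp add: defect_def)

lemma tendsto_defect: "0 \<le> t \<Longrightarrow> (defect t \<longlongrightarrow> 0) (at_right 0)"
  using tendsto_diff[OF tendsto_const tendsto_laplace_0[OF in_N], of t "m0 (v t)"]
  by (simp add: defect_def [abs_def])

text \<open>The identity \<open>characteristic\<close> recentred at the foot, so that a Taylor
  expansion of \<open>moment 0\<close> there can be read as an equation for the defect.\<close>

lemma moment_shift:
  assumes "0 \<le> t" "0 < x"
  shows "moment 0 (foot t + (x + t * defect t x)) = m0 (v t) - defect t x"
proof -
  have "foot t + (x + t * defect t x) = x + \<mu> t - t * laplace (v t) x"
    by (simp add: foot_def defect_def algebra_simps)
  then have "moment 0 (foot t + (x + t * defect t x)) = moment 0 (x + \<mu> t - t * laplace (v t) x)"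
    by (rule arg_cong)
  then show ?thesis
    using characteristic[OF assms] by (simp add: laplace_eq_moment defect_def)
qed

lemma filterlim_shift:
  assumes "0 \<le> t"
  shows "filterlim (\<lambda>x. x + t * defect t x) (at 0) (at_right 0)"
proof -
  have "((\<lambda>x. x + t * defect t x) \<longlongrightarrow> 0 + t * 0) (at_right 0)"
    by (intro tendsto_intros tendsto_defect assms)
  moreover have "\<forall>\<^sub>F x in at_right 0. x + t * defect t x \<noteq> 0"
    using eventually_at_right_less[of 0]
  proof eventually_elim
    case (elim x)
    then show ?case
      using mult_nonneg_nonneg[OF assms defect_nonneg[OF assms, of x]] by simp
  qed
  ultimately show ?thesis
    by (simp add: filterlim_at)
qed

text \<open>The difference quotient of \<open>moment 0\<close> at the foot with increment
  \<open>x + t * defect t x\<close> is \<open>- defect t x / (x + t * defect t x)\<close>, at least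
  \<open>- 1 / t\<close> because \<open>x > 0\<close>. Its limit is the derivative.\<close>

lemma moment_1_foot_le:
  assumes "0 \<le> t"
  shows "t * moment 1 (foot t) \<le> 1"
proof (cases "t = 0")
  case False
  with assms have t: "0 < t" by simp
  let ?h = "\<lambda>x. x + t * defect t x"
  have "((\<lambda>h. (moment 0 (foot t + h) - moment 0 (foot t)) / h) \<longlongrightarrow> - moment 1 (foot t)) (at 0)"
    using moment_deriv[of 0 "foot t" UNIV] by (simp add: DERIV_def)
  from filterlim_compose[OF this filterlim_shift[OF assms]]
  have "- moment 1 (foot t) \<ge> - (1 / t)"
  proof (rule tendsto_lowerbound)
    show "\<forall>\<^sub>F x in at_right 0. - (1 / t) \<le> (moment 0 (foot t + ?h x) - moment 0 (foot t)) / ?h x"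
      using eventually_at_right_less[of 0]
    proof eventually_elim
      case (elim x)
      have "0 < ?h x"
        using elim mult_nonneg_nonneg[OF assms defect_nonneg[OF assms, of x]] by simp
      then show ?case
        unfolding moment_shift[OF assms elim] moment_foot[OF assms] using t elim by (simp add: field_simps)
    qed
  qed simp
  then show ?thesis
    using t by (simp add: field_simps)
qed simp

text \<open>In this range of \<open>t\<close>, \<open>?G\<close> increases strictly on
  \<open>y > 0\<close>. Its value at the foot is \<open>\<mu> t \<le> t * m0 (v 0)\<close>, which is
  its value at \<open>0\<close>, so the foot cannot be positive. The case \<open>t = tgel\<close> is
  included and anchors the later comparison.\<close>

lemma pregelation:
  assumes "0 \<le> t" "t * moment 1 0 \<le> 1"
  shows "foot t = 0" "m0 (v t) = m0 (v 0)"
proof -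
  let ?G = "\<lambda>y. y + t * moment 0 y"
  have G': "(?G has_real_derivative 1 - t * moment 1 y) (at y within S)" for y S
    by (rule derivative_eq_intros moment_deriv refl | simp)+
  show f: "foot t = 0"
  proof (rule ccontr)
    assume "foot t \<noteq> 0"
    then have f: "0 < foot t"
      using foot_nonneg[OF assms(1)] by simp
    have "?G 0 < ?G (foot t)"
    proof (rule DERIV_pos_imp_increasing_open[OF f])
      fix y assume y: "0 < y" "y < foot t"
      have "t * moment 1 y < 1"
      proof (cases "t = 0")
        case False
        then have "t * moment 1 y < t * moment 1 0"
          using assms(1) y by (simp add: moment_strict_antimono)
        then show ?thesis
          using assms(2) by simp
      qed simp
      then show "\<exists>d. (?G has_real_derivative d) (at y) \<and> 0 < d"
        using G'[of y UNIV] by auto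
    qed (rule DERIV_continuous_on[OF G'])
    moreover have "?G (foot t) = \<mu> t"
      using moment_foot[OF assms(1)] by (simp add: foot_def)
    moreover have "\<mu> t \<le> ?G 0"
      using \<mu>_diff_bounds(2)[of 0 t] assms(1) by (simp add: \<mu>_def moment_0_0 mult.commute)
    ultimately show False
      by simp
  qed
  show "m0 (v t) = m0 (v 0)"
    using moment_foot[OF assms(1)] f by (simp add: moment_0_0)
qed

definition tgel :: real where
  "tgel = 1 / moment 1 0"

lemma tgel_pos: "0 < tgel"
  by (simp add: tgel_def moment_pos)

lemma ystar_tgel: "ystar tgel = 0"
  by (simp add: tgel_def ystar_inverse)

lemma ystar_le_foot:
  assumes "0 < t"
  shows "ystar t \<le> foot t"
proof -
  have "moment 1 (foot t) \<le> moment 1 (ystar t)"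
    using moment_1_foot_le[of t] assms by (simp add: moment_ystar field_simps)
  then show ?thesis
    by (simp add: moment_le_iff)
qed

text \<open>\<open>L t\<close> is the minimum over \<open>y\<close> of \<open>y + t * moment 0 y\<close>, attained only at \<open>ystar t\<close>, while \<open>\<mu> t\<close>
  is the value of this function at \<open>foot t\<close>; hence \<open>L \<le> \<mu>\<close>. The two agree at \<open>tgel\<close>, and
  the derivative of \<open>L\<close> dominates that of \<open>\<mu>\<close>, so they coincide from then on.\<close>

lemma foot_eq_ystar:
  assumes t: "tgel \<le> t"
  shows "foot t = ystar t"
proof (rule ccontr)
  have t0: "0 < t"
    using t tgel_pos by simp
  assume "foot t \<noteq> ystar t"
  then have less: "ystar t < foot t"
    using ystar_le_foot[OF t0] by simp
  define L where "L = (\<lambda>s. ystar s + s * moment 0 (ystar s))"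
  \<comment> \<open>An envelope identity: \<open>moment 1 (ystar s) = 1 / s\<close> makes the two
    contributions of the derivative of \<open>ystar\<close> cancel.\<close>
  have L': "(L has_real_derivative moment 0 (ystar s)) (at s within S)" if "0 < s" for s S
  proof -
    let ?d = "1 / (s\<^sup>2 * moment 2 (ystar s))"
    have "((\<lambda>s. moment 0 (ystar s)) has_real_derivative - moment (0 + 1) (ystar s) * ?d) (at s within S)"
      by (rule DERIV_chain2[OF moment_deriv ystar_deriv[OF that]])
    then have "(L has_real_derivative ?d + (1 * moment 0 (ystar s) + - moment (0 + 1) (ystar s) * ?d * s)) (at s within S)"
      unfolding L_def by (intro DERIV_add DERIV_mult ystar_deriv[OF that] DERIV_ident)
    then show ?thesis
      using that moment_ystar[OF that] by simp
  qed
  have intL: "((\<lambda>s. moment 0 (ystar s)) has_integral L t - L tgel) {tgel..t}"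
    using t tgel_pos L'
    by (intro fundamental_theorem_of_calculus) (auto simp: has_real_derivative_iff_has_vector_derivative[symmetric])
  have int\<mu>: "((\<lambda>s. m0 (v s)) has_integral \<mu> t - \<mu> tgel) {tgel..t}"
    using t tgel_pos by (simp add: \<mu>_diff m0_integrable integrable_integral)
  have "\<mu> t - \<mu> tgel \<le> L t - L tgel"
  proof (rule has_integral_le[OF int\<mu> intL])
    fix s assume "s \<in> {tgel..t}"
    then have s: "0 < s"
      using tgel_pos by simp
    have "m0 (v s) = moment 0 (foot s)"
      using moment_foot[of s] s by simp
    also have "\<dots> \<le> moment 0 (ystar s)"
      by (rule moment_antimono[OF ystar_le_foot[OF s]])
    finally show "m0 (v s) \<le> moment 0 (ystar s)" .
  qed
  moreover have "\<mu> tgel = L tgel"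
  proof -
    have "0 \<le> tgel" "tgel * moment 1 0 \<le> 1"
      using tgel_pos moment_pos[of 1 0] by (auto simp: tgel_def)
    from pregelation[OF this] show ?thesis
      by (simp add: L_def ystar_tgel foot_def moment_0_0)
  qed
  moreover have "L t < \<mu> t"
  proof -
    let ?G = "\<lambda>y. y + t * moment 0 y"
    have G': "(?G has_real_derivative 1 - t * moment 1 y) (at y within S)" for y S
      by (rule derivative_eq_intros moment_deriv refl | simp)+
    have "?G (ystar t) < ?G (foot t)"
    proof (rule DERIV_pos_imp_increasing_open[OF less])
      fix y assume "ystar t < y" "y < foot t"
      then have "t * moment 1 y < t * moment 1 (ystar t)"
        using t0 by (simp add: moment_strict_antimono)
      then have "0 < 1 - t * moment 1 y"
        using moment_ystar[OF t0] t0 by simp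
      then show "\<exists>d. (?G has_real_derivative d) (at y) \<and> 0 < d"
        using G'[of y UNIV] by auto
    qed (rule DERIV_continuous_on[OF G'])
    then show ?thesis
      using moment_foot[of t] t0 by (simp add: L_def foot_def)
  qed
  ultimately show False
    by simp
qed

section \<open>The gelation rate and the square root singularity of the defect\<close>

definition \<phi> :: "real \<Rightarrow> real" where
  "\<phi> t = 1 / (t ^ 3 * moment 2 (ystar t))"

lemma \<phi>_pos: "tgel \<le> t \<Longrightarrow> 0 < \<phi> t"
  using tgel_pos moment_pos[of 2 "ystar t"] by (simp add: \<phi>_def)

lemma continuous_on_\<phi>: "continuous_on {tgel..} \<phi>"
proof -
  have c: "continuous_on {tgel..} ystar"
    by (rule DERIV_continuous_on[OF ystar_deriv]) (use tgel_pos in auto)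
  have "continuous_on {tgel..} (\<lambda>t. moment 2 (ystar t))"
    by (rule continuous_on_compose2[OF _ c, of UNIV]) (auto simp: continuous_on_eq_continuous_at isCont_moment)
  moreover have "t ^ 3 * moment 2 (ystar t) \<noteq> 0" if "t \<in> {tgel..}" for t
    using that tgel_pos moment_pos[of 2 "ystar t"] by auto
  ultimately show ?thesis
    unfolding \<phi>_def by (intro continuous_intros) auto
qed

text \<open>\<open>- moment 0 (ystar s)\<close> has derivative
  \<open>moment 1 (ystar s) = 1 / s\<close> times that of \<open>ystar\<close>, which is
  \<open>\<phi> s\<close>; after gelation \<open>moment 0 (ystar t)\<close> is
  \<open>m0 (v t)\<close>.\<close>

lemma \<phi>_has_integral:
  assumes t: "tgel \<le> t"
  shows "(\<phi> has_integral m0 (v 0) - m0 (v t)) {tgel..t}"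
proof -
  have d: "((\<lambda>s. - moment 0 (ystar s)) has_real_derivative \<phi> s) (at s within {tgel..t})" if "s \<in> {tgel..t}" for s
  proof -
    have s: "0 < s"
      using that tgel_pos by simp
    have "((\<lambda>s. - moment 0 (ystar s)) has_real_derivative - (- moment (0 + 1) (ystar s) * (1 / (s\<^sup>2 * moment 2 (ystar s))))) (at s within {tgel..t})"
      by (intro DERIV_minus DERIV_chain2[OF moment_deriv ystar_deriv] s)
    then show ?thesis
      using moment_ystar[OF s] s by (simp add: \<phi>_def power2_eq_square power3_eq_cube mult_ac)
  qed
  then have "(\<phi> has_integral - moment 0 (ystar t) - - moment 0 (ystar tgel)) {tgel..t}"
    by (intro fundamental_theorem_of_calculus[OF t]) (simp add: has_real_derivative_iff_has_vector_derivative)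
  moreover have "moment 0 (ystar t) = m0 (v t)"
    using moment_foot[of t] foot_eq_ystar[OF t] t tgel_pos by simp
  ultimately show ?thesis
    by (simp add: ystar_tgel moment_0_0)
qed

lemma moment_second_order:
  "((\<lambda>h. (moment 0 (y + h) - moment 0 y + moment 1 y * h) / h\<^sup>2) \<longlongrightarrow> moment 2 y / 2) (at 0)"
proof -
  have "((\<lambda>h. \<Sum>k | v 0 k \<noteq> 0. v 0 k * exp (- (real k * y)) * ((exp (- (real k * h)) - 1 + real k * h) / h\<^sup>2))
      \<longlongrightarrow> (\<Sum>k | v 0 k \<noteq> 0. v 0 k * exp (- (real k * y)) * ((real k)\<^sup>2 / 2))) (at 0)"
    by (intro tendsto_sum tendsto_mult tendsto_const tendsto_exp_second_order)
  moreover have "(\<Sum>k | v 0 k \<noteq> 0. v 0 k * exp (- (real k * y)) * ((real k)\<^sup>2 / 2)) = moment 2 y / 2"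
    by (simp add: moment_def sum_divide_distrib mult_ac)
  moreover have "(\<Sum>k | v 0 k \<noteq> 0. v 0 k * exp (- (real k * y)) * ((exp (- (real k * h)) - 1 + real k * h) / h\<^sup>2))
      = (moment 0 (y + h) - moment 0 y + moment 1 y * h) / h\<^sup>2" for h
    unfolding moment_def sum_subtractf[symmetric] sum_distrib_right sum.distrib[symmetric] sum_divide_distrib
  proof (rule sum.cong[OF refl])
    fix k
    have "exp (- (real k * (y + h))) = exp (- (real k * y)) * exp (- (real k * h))"
      by (simp add: algebra_simps flip: exp_add)
    then show "v 0 k * exp (- (real k * y)) * ((exp (- (real k * h)) - 1 + real k * h) / h\<^sup>2)
      = (real k ^ 0 * v 0 k * exp (- (real k * (y + h))) - real k ^ 0 * v 0 k * exp (- (real k * y))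
          + real k ^ 1 * v 0 k * exp (- (real k * y)) * h) / h\<^sup>2"
      by (simp add: algebra_simps)
  qed
  ultimately show ?thesis
    by (simp only:)
qed

text \<open>At the foot the slope of \<open>moment 0\<close> is exactly \<open>- 1 / t\<close>, so
  in the second-order expansion \<open>h x / t - defect t x\<close> collapses to
  \<open>x / t\<close>. Hence \<open>x / (t * (h x)\<twosuperior>)\<close> tends to
  \<open>moment 2 y / 2\<close>, which determines \<open>h x / sqrt x\<close>.\<close>

lemma defect_asymptotics:
  assumes t: "tgel \<le> t"
  shows "((\<lambda>x. defect t x / sqrt x) \<longlongrightarrow> sqrt (2 * \<phi> t)) (at_right 0)"
proof -
  have t0: "0 < t" "0 \<le> t"
    using t tgel_pos by auto
  define y where "y = ystar t"
  define h where "h = (\<lambda>x. x + t * defect t x)"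
  have h_pos: "0 < h x" if "0 < x" for x
    using that mult_nonneg_nonneg[OF t0(2) defect_nonneg[OF t0(2), of x]] by (simp add: h_def)
  have "((\<lambda>x. (moment 0 (y + h x) - moment 0 y + moment 1 y * h x) / (h x)\<^sup>2) \<longlongrightarrow> moment 2 y / 2) (at_right 0)"
    using filterlim_compose[OF moment_second_order filterlim_shift[OF t0(2)]] by (simp add: h_def)
  moreover have "\<forall>\<^sub>F x in at_right 0. (moment 0 (y + h x) - moment 0 y + moment 1 y * h x) / (h x)\<^sup>2 = x / (t * (h x)\<^sup>2)"
    using eventually_at_right_less[of 0]
  proof eventually_elim
    case (elim x)
    have "moment 0 (y + h x) - moment 0 y + moment 1 y * h x = - defect t x + h x / t"
      using moment_shift[OF t0(2) elim] moment_foot[OF t0(2)] moment_ystar[OF t0(1)] foot_eq_ystar[OF t]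
      by (simp add: y_def h_def)
    also have "\<dots> = x / t"
      using t0 by (simp add: h_def field_simps)
    finally show ?case
      by simp
  qed
  ultimately have "((\<lambda>x. x / (t * (h x)\<^sup>2)) \<longlongrightarrow> moment 2 y / 2) (at_right 0)"
    by (rule Lim_transform_eventually)
  \<comment> \<open>The root is \<open>sqrt x / h x\<close>. Inverting it, subtracting
    \<open>sqrt x\<close> and dividing by \<open>t\<close> recovers
    \<open>defect t x / sqrt x\<close>.\<close>
  then have "((\<lambda>x. sqrt (t * (x / (t * (h x)\<^sup>2)))) \<longlongrightarrow> sqrt (t * (moment 2 y / 2))) (at_right 0)"
    by (rule tendsto_real_sqrt[OF tendsto_mult[OF tendsto_const]])
  then have "((\<lambda>x. 1 / sqrt (t * (x / (t * (h x)\<^sup>2)))) \<longlongrightarrow> 1 / sqrt (t * (moment 2 y / 2))) (at_right 0)"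
    using t0 moment_pos[of 2 y] by (intro tendsto_divide[OF tendsto_const]) auto
  moreover have "((\<lambda>x. sqrt x) \<longlongrightarrow> sqrt 0) (at_right 0)"
    by (intro tendsto_intros)
  ultimately have "((\<lambda>x. (1 / sqrt (t * (x / (t * (h x)\<^sup>2))) - sqrt x) / t) \<longlongrightarrow> (1 / sqrt (t * (moment 2 y / 2)) - sqrt 0) / t) (at_right 0)"
    by (rule tendsto_divide[OF tendsto_diff tendsto_const]) (use t0 in simp)
  moreover have "(1 / sqrt (t * (moment 2 y / 2)) - sqrt 0) / t = sqrt (2 * \<phi> t)"
  proof (rule real_sqrt_unique[symmetric])
    show "((1 / sqrt (t * (moment 2 y / 2)) - sqrt 0) / t)\<^sup>2 = 2 * \<phi> t"
    proof -
      have "((1 / sqrt (t * (moment 2 y / 2)) - sqrt 0) / t)\<^sup>2 = 1 / (t * (moment 2 y / 2)) / t\<^sup>2"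
        using t0 moment_pos[of 2 y] by (simp add: power_divide power_mult_distrib less_imp_le)
      then show ?thesis
        by (simp add: \<phi>_def y_def power2_eq_square power3_eq_cube)
    qed
    show "0 \<le> (1 / sqrt (t * (moment 2 y / 2)) - sqrt 0) / t"
      using t0 moment_pos[of 2 y] by simp
  qed
  moreover have "\<forall>\<^sub>F x in at_right 0. (1 / sqrt (t * (x / (t * (h x)\<^sup>2))) - sqrt x) / t = defect t x / sqrt x"
    using eventually_at_right_less[of 0]
  proof eventually_elim
    case (elim x)
    have "sqrt (t * (x / (t * (h x)\<^sup>2))) = sqrt x / h x"
      using h_pos[OF elim] t0 by (simp add: real_sqrt_divide)
    then have "(1 / sqrt (t * (x / (t * (h x)\<^sup>2))) - sqrt x) / t = (h x / sqrt x - sqrt x) / t"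
      by simp
    also have "h x / sqrt x - sqrt x = t * (defect t x / sqrt x)"
      using elim by (simp add: h_def field_simps)
    finally show ?case
      using t0 by simp
  qed
  ultimately show ?thesis
    by (auto elim: Lim_transform_eventually)
qed

section \<open>The first moment on either side of the gelation time\<close>

lemma partial_m1_le:
  assumes t: "0 \<le> t" and D: "\<And>x. 0 < x \<Longrightarrow> defect t x \<le> D * x"
  shows "(\<Sum>k<n. real k * v t k) \<le> D"
proof (rule tendsto_upperbound)
  \<comment> \<open>Each summand of \<open>defect t x / x\<close> tends to
    \<open>real k * v t k\<close>, so a bound on that quotient uniform in \<open>x\<close> passes to
    every finite partial sum of the first moment.\<close>
  have lim: "((\<lambda>x::real. (1 - exp (- (real k * x))) / x) \<longlongrightarrow> real k) (at_right 0)" for k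
    by real_asymp
  show "((\<lambda>x. \<Sum>k<n. (1 - exp (- (real k * x))) / x * v t k) \<longlongrightarrow> (\<Sum>k<n. real k * v t k)) (at_right 0)"
    by (intro tendsto_intros lim)
  show "\<forall>\<^sub>F x in at_right 0. (\<Sum>k<n. (1 - exp (- (real k * x))) / x * v t k) \<le> D"
    using eventually_at_right_less[of 0]
  proof eventually_elim
    case (elim x)
    note N = in_N[OF t]
    have s: "summable (\<lambda>k. v t k - v t k * exp (- (real k * x)))"
      using elim by (intro summable_diff in_N_summable[OF N] summable_laplace[OF N]) auto
    have "(\<Sum>k<n. v t k - v t k * exp (- (real k * x))) \<le> (\<Sum>k. v t k - v t k * exp (- (real k * x)))"
      using elim in_N_nonneg[OF N] by (intro sum_le_suminf s) (auto intro!: mult_left_le)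
    also have "\<dots> = defect t x"
      using elim by (simp add: defect_def m0_def laplace_def suminf_diff in_N_summable[OF N] summable_laplace[OF N])
    also have "\<dots> \<le> D * x"
      by (rule D[OF elim])
    finally have "(\<Sum>k<n. v t k - v t k * exp (- (real k * x))) / x \<le> D"
      using elim by (simp add: field_simps)
    then show ?case
      by (simp add: sum_divide_distrib algebra_simps)
  qed
qed simp

text \<open>The foot is \<open>0\<close> and \<open>moment 0\<close> falls there with slope at most
  \<open>moment 1 0\<close>, so \<open>defect t x \<le> moment 1 0 * (x + t * defect t x)\<close>.
  As \<open>t * moment 1 0 < 1\<close>, this can be solved for the defect, which gives the constant
  \<open>D\<close>.\<close>

lemma m1_finite_before:
  assumes t: "0 \<le> t" "t < tgel"
  shows "m1 (v t) \<noteq> \<infinity>"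
proof -
  have b: "0 < 1 - t * moment 1 0"
    using t moment_pos[of 1 0] by (simp add: tgel_def field_simps)
  define D where "D = moment 1 0 / (1 - t * moment 1 0)"
  have "defect t x \<le> D * x" if x: "0 < x" for x
  proof -
    let ?h = "x + t * defect t x"
    have "moment 0 ?h = moment 0 0 - defect t x"
      using moment_shift[OF t(1) x] pregelation[of t] t b by (simp add: moment_0_0)
    moreover have "moment 0 0 - moment 0 ?h \<le> moment 1 0 * ?h"
      unfolding moment_def sum_subtractf[symmetric] sum_distrib_right
    proof (rule sum_mono)
      fix k assume "k \<in> {k. v 0 k \<noteq> 0}"
      then have "v 0 k * (1 - exp (- (real k * ?h))) \<le> v 0 k * (real k * ?h)"
        using support_pos[of k] exp_ge_add_one_self[of "- (real k * ?h)"] by (intro mult_left_mono) auto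
      then show "real k ^ 0 * v 0 k * exp (- (real k * 0)) - real k ^ 0 * v 0 k * exp (- (real k * ?h))
          \<le> real k ^ 1 * v 0 k * exp (- (real k * 0)) * ?h"
        by (simp add: algebra_simps)
    qed
    ultimately have "defect t x * (1 - t * moment 1 0) \<le> x * moment 1 0"
      by (simp add: algebra_simps)
    then show ?thesis
      using b by (simp add: D_def field_simps)
  qed
  from partial_m1_le[OF t(1) this] have "m1 (v t) \<le> ereal D"
    unfolding m1_def using in_N_nonneg[OF in_N[OF t(1)]] by (intro suminf_bound) auto
  then show ?thesis
    by auto
qed

text \<open>A finite first moment would bound the defect by a multiple of \<open>x\<close>, forcing
  \<open>defect t x / sqrt x\<close> to \<open>0\<close> against its positive limit.\<close>

lemma m1_infinite_after:
  assumes t: "tgel \<le> t"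
  shows "m1 (v t) = \<infinity>"
proof (rule ccontr)
  assume inf: "m1 (v t) \<noteq> \<infinity>"
  have t0: "0 \<le> t"
    using t tgel_pos by simp
  note N = in_N[OF t0]
  have le: "ereal (\<Sum>k<n. real k * v t k) \<le> m1 (v t)" for n
    using suminf_upper[of "\<lambda>k. ereal (real k * v t k)" n] in_N_nonneg[OF N] by (simp add: m1_def)
  then obtain S where S: "m1 (v t) = ereal S"
    using inf le[of 0] by (cases "m1 (v t)") auto
  have sum1: "summable (\<lambda>k. real k * v t k)"
    using le in_N_nonneg[OF N] by (intro summableI_nonneg_bounded[where x = S]) (auto simp: S)
  have le_S: "(\<Sum>k. real k * v t k) \<le> S"
    using le by (intro suminf_le_const sum1) (auto simp: S)
  have defect_le: "defect t x \<le> x * S" if x: "0 < x" for x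
  proof -
    have "defect t x = (\<Sum>k. v t k - v t k * exp (- (real k * x)))"
      using x by (simp add: defect_def m0_def laplace_def suminf_diff in_N_summable[OF N] summable_laplace[OF N])
    also have "\<dots> \<le> (\<Sum>k. x * (real k * v t k))"
    proof (rule suminf_le)
      fix k
      have "v t k * (1 - exp (- (real k * x))) \<le> v t k * (real k * x)"
        using in_N_nonneg[OF N, of k] exp_ge_add_one_self[of "- (real k * x)"] by (intro mult_left_mono) auto
      then show "v t k - v t k * exp (- (real k * x)) \<le> x * (real k * v t k)"
        by (simp add: algebra_simps)
    qed (use x in \<open>auto intro!: summable_diff summable_mult sum1 in_N_summable[OF N] summable_laplace[OF N]\<close>)
    also have "\<dots> = x * (\<Sum>k. real k * v t k)"
      by (rule suminf_mult[OF sum1])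
    also have "\<dots> \<le> x * S"
      using x le_S by simp
    finally show ?thesis .
  qed
  have "\<forall>\<^sub>F x in at_right 0. defect t x / sqrt x \<le> sqrt x * S"
    using eventually_at_right_less[of 0]
  proof eventually_elim
    case (elim x)
    have "(sqrt x * S) * sqrt x = (sqrt x * sqrt x) * S"
      by (simp only: mult_ac)
    also have "\<dots> = x * S"
      using elim by simp
    finally have e: "(sqrt x * S) * sqrt x = x * S" .
    show ?case
      using elim defect_le[OF elim] by (simp only: pos_divide_le_eq real_sqrt_gt_0_iff e)
  qed
  moreover have "((\<lambda>x. sqrt x * S) \<longlongrightarrow> sqrt 0 * S) (at_right 0)"
    by (intro tendsto_intros)
  ultimately have "sqrt (2 * \<phi> t) \<le> sqrt 0 * S"
    by (intro tendsto_le[OF _ _ defect_asymptotics[OF t]]) auto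
  then show False
    using \<phi>_pos[OF t] by simp
qed

lemma gelation_time: "(INF t\<in>{t. 0 \<le> t \<and> m1 (v t) = \<infinity>}. ereal t) = ereal tgel"
proof -
  have "{t. 0 \<le> t \<and> m1 (v t) = \<infinity>} = {tgel..}"
    using m1_finite_before m1_infinite_after tgel_pos by force
  then show ?thesis
    by (auto intro!: antisym INF_lower INF_greatest)
qed

text \<open>The tails \<open>T\<close> are nonnegative and decreasing, as the monotone Tauberian
  theorem requires; dividing \<open>sqrt (2 * \<phi> t)\<close> by \<open>sqrt pi\<close> gives the
  constant.\<close>

lemma tail_asymptotics:
  assumes t: "tgel \<le> t"
  shows "(\<lambda>K. sqrt (real K) * (\<Sum>n. v t (n + K))) \<longlonglongrightarrow> sqrt (2 * \<phi> t / pi)"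
proof -
  have t0: "0 \<le> t"
    using t tgel_pos by simp
  note N = in_N[OF t0]
  define T where "T = (\<lambda>K. \<Sum>n. v t (n + K))"
  have sT: "summable (\<lambda>n. v t (n + K))" for K
    using in_N_summable[OF N] by (rule summable_ignore_initial_segment)
  have T_nonneg: "0 \<le> T K" for K
    unfolding T_def using in_N_nonneg[OF N] by (intro suminf_nonneg sT) auto
  have T_Suc: "T K = v t K + T (Suc K)" for K
    using suminf_split_head[OF sT, of K] by (simp add: T_def)
  have "T (Suc K) \<le> T K" for K
    using T_Suc[of K] in_N_nonneg[OF N, of K] by simp
  then have anti: "antimono T"
    by (rule decseq_SucI)
  have T_0: "T 0 = m0 (v t)"
    by (simp add: T_def m0_def)
  have summable_T: "summable (\<lambda>n. T n * exp (- (real n * x)))" if x: "0 < x" for x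
  proof (rule summable_comparison_test')
    show "summable (\<lambda>n. T 0 * exp (- x) ^ n)"
      using x by (intro summable_mult summable_geometric) simp
    show "norm (T n * exp (- (real n * x))) \<le> T 0 * exp (- x) ^ n" for n
      using T_nonneg[of n] antimonoD[OF anti, of 0 n]
      by (auto simp: abs_mult intro!: mult_right_mono simp flip: exp_of_nat_mult)
  qed
  \<comment> \<open>Summation by parts from \<open>v t n = T n - T (Suc n)\<close>. The second term
    stays bounded as \<open>x\<close> tends to \<open>0\<close>, so the factor \<open>sqrt x\<close>
    removes it in the limit.\<close>
  have F: "(\<Sum>n. T n * exp (- (real n * x))) = defect t x / (1 - exp (- x)) + laplace (v t) x" if x: "0 < x" for x
  proof -
    let ?F = "\<Sum>n. T n * exp (- (real n * x))" and ?q = "exp (- x)"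
    have s2: "summable (\<lambda>n. T (Suc n) * exp (- (real n * x)))"
    proof (rule summable_comparison_test'[OF summable_T[OF x]])
      show "norm (T (Suc n) * exp (- (real n * x))) \<le> T n * exp (- (real n * x))" for n
        using T_nonneg[of "Suc n"] antimonoD[OF anti, of n "Suc n"] by (auto simp: abs_mult)
    qed
    have "?F = T 0 + (\<Sum>n. T (Suc n) * exp (- (real (Suc n) * x)))"
      using suminf_split_head[OF summable_T[OF x]] by simp
    also have "(\<Sum>n. T (Suc n) * exp (- (real (Suc n) * x))) = (\<Sum>n. ?q * (T (Suc n) * exp (- (real n * x))))"
      by (intro arg_cong[where f = suminf] ext) (simp add: algebra_simps exp_add exp_diff exp_minus field_simps)
    also have "\<dots> = ?q * (\<Sum>n. T (Suc n) * exp (- (real n * x)))"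
      by (rule suminf_mult[OF s2])
    also have "(\<Sum>n. T (Suc n) * exp (- (real n * x))) = ?F - laplace (v t) x"
    proof -
      have "laplace (v t) x = (\<Sum>n. T n * exp (- (real n * x)) - T (Suc n) * exp (- (real n * x)))"
        unfolding laplace_def by (subst T_Suc) (simp add: algebra_simps)
      also have "\<dots> = ?F - (\<Sum>n. T (Suc n) * exp (- (real n * x)))"
        by (rule suminf_diff[OF summable_T[OF x] s2, symmetric])
      finally show ?thesis
        by simp
    qed
    finally have "?F * (1 - ?q) = defect t x + laplace (v t) x * (1 - ?q)"
      by (simp add: T_0 defect_def algebra_simps)
    moreover have "1 - ?q \<noteq> 0"
      using x by simp
    ultimately show ?thesis
      by (simp add: field_simps)
  qed
  have "((\<lambda>x. defect t x / sqrt x * (x / (1 - exp (- x))) + sqrt x * laplace (v t) x)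
      \<longlongrightarrow> sqrt (2 * \<phi> t) * 1 + sqrt 0 * m0 (v t)) (at_right 0)"
  proof (intro tendsto_add tendsto_mult defect_asymptotics t tendsto_laplace_0 N)
    show "((\<lambda>x::real. x / (1 - exp (- x))) \<longlongrightarrow> 1) (at_right 0)"
      by real_asymp
    show "(sqrt \<longlongrightarrow> sqrt 0) (at_right 0)"
      by (intro tendsto_intros)
  qed
  moreover have "\<forall>\<^sub>F x in at_right 0. defect t x / sqrt x * (x / (1 - exp (- x))) + sqrt x * laplace (v t) x
      = sqrt x * (\<Sum>n. T n * exp (- (real n * x)))"
    using eventually_at_right_less[of 0]
  proof eventually_elim
    case (elim x)
    have "d / s * (s * s / q) = s * (d / q)" if "s \<noteq> 0" for d s q :: real
      using that by simp
    from this[of "sqrt x"] have "defect t x / sqrt x * (x / (1 - exp (- x))) = sqrt x * (defect t x / (1 - exp (- x)))"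
      using elim by simp
    then show ?case
      by (simp only: F[OF elim] distrib_left)
  qed
  ultimately have lim: "((\<lambda>x. sqrt x * (\<Sum>n. T n * exp (- (real n * x)))) \<longlongrightarrow> sqrt (2 * \<phi> t)) (at_right 0)"
    by (auto elim: Lim_transform_eventually)
  interpret half_laplace T "sqrt (2 * \<phi> t)"
    by unfold_locales (fact T_nonneg summable_T lim)+
  show ?thesis
    using monotone_tauberian[OF anti] by (simp add: T_def real_sqrt_divide)
qed

end

theorem theorem5:
  fixes v :: "real \<Rightarrow> nat \<Rightarrow> real"
  assumes init: "in_Nstar (v 0)"
    and sol: "crit_solution v"
  shows "(INF t\<in>{t. 0 \<le> t \<and> m1 (v t) = \<infinity>}. ereal t) = 1 / m1 (v 0)
    \<and> (let tgel = 1 / real_of_ereal (m1 (v 0)) in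
       \<exists>\<phi> :: real \<Rightarrow> real.
         continuous_on {tgel..} \<phi> \<and> (\<forall>t\<ge>tgel. \<phi> t > 0) \<and>
         (\<forall>t\<ge>tgel. \<phi> integrable_on {tgel..t} \<and>
                    m0 (v 0) - m0 (v t) = integral {tgel..t} \<phi>) \<and>
         (\<forall>t\<ge>tgel. ((\<lambda>K. sqrt (real K) * (\<Sum>n. v t (n + K)))
                       \<longlongrightarrow> sqrt (2 * \<phi> t / pi)) sequentially))"
proof -
  interpret critical_finite v
    by unfold_locales (fact sol init)+
  have "1 / m1 (v 0) = ereal tgel" "1 / real_of_ereal (m1 (v 0)) = tgel"
    using moment_pos[of 1 0] by (auto simp: m1_initial tgel_def one_ereal_def)
  moreover have "\<phi> integrable_on {tgel..t} \<and> m0 (v 0) - m0 (v t) = integral {tgel..t} \<phi>" if "tgel \<le> t" for t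
    using \<phi>_has_integral[OF that] by (simp add: has_integral_integrable integral_unique)
  ultimately show ?thesis
    unfolding Let_def
    by (intro conjI exI[of _ \<phi>] allI impI) (simp_all add: gelation_time continuous_on_\<phi> \<phi>_pos tail_asymptotics)
qed

end
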